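(* Suppose $\omega(x)\le1/\|x\|$ for all $x\in\mathbb{R}^d\setminus\{0\}$. For all $u,v>0$ one has $$\mathbb{P}\Big\{\sup_{V\in\mathcal{V}_p}|R_{n,k}(V)-R_{t_{n,k}}(V)|\ge\Big[\frac{p\wedge(d-p)}{k}S_{t_{n,k}}\Big]^{1/2}+u+v\Big\}\le2\exp\Big(-\frac{ku^2}{2(1+k/n+u/3)}\Big)+2\exp\Big(-\frac{kv^2}{2(1+v/3)}\Big)$$ with $S_t:=\mathbb{E}_t\|\Theta\|^4-\pi_t\operatorname{tr}(\Sigma_t^2)$. In particular, for $\delta\in(0,1)$, with probability greater than or equal to $1-\delta$, \begin{align*} \sup_{V\in\mathcal{V}_p}|R_{n,k}(V)-R_{t_{n,k}}(V)| &\le\Big[\frac{p\wedge(d-p)}{k}S_{t_{n,k}}\Big]^{1/2}+\frac{2\log(4/\delta)}{3k}+\Big[\Big(\frac{\log(4/\delta)}{3k}\Big)^2+\frac2k(1+k/n)\log(4/\delta)\Big]^{1/2}\\ &\quad+\Big[\Big(\frac{\log(4/\delta)}{3k}\Big)^2+\frac2k\log(4/\delta)\Big]^{1/2}\\ &\le\Big[\frac{p\wedge(d-p)}{k}S_{t_{n,k}}\Big]^{1/2}+\Big[\frac8k(1+k/n)\log(4/\delta)\Big]^{1/2}+\frac{4\log(4/\delta)}{3k}. \end{align*}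
   Context: Let $\|\cdot\|$ be the Euclidean norm on $\mathbb{R}^d$. $X$ is an $\mathbb{R}^d$-valued random vector (probability $\mathbb{P}$, expectation $\mathbb{E}$) that is regularly varying: there exist a function $b:(0,\infty)\to(0,\infty)$ and a non-zero Borel measure $\mu$ on $\mathbb{R}^d\setminus\{0\}$ such that $b(t)^{-1}\mathbb{P}(X\in tB)\to\mu(B)<\infty$ as $t\to\infty$ for all Borel sets $B$ bounded away from the origin with $\mu(\partial B)=0$ (in particular $\mathbb{P}\{\|X\|>t\}>0$ for all $t$). The scaling function is a measurable $\omega:\mathbb{R}^d\setminus\{0\}\to(0,\infty)$; $\theta(x)=\omega(x)x$ for $x\neq0$, $\theta(0)=0$, $\Theta=\theta(X)$. $\pi_t=\mathbb{P}\{\|X\|>t\}$; $\mathbb{E}_t$ is conditional expectation given $\|X\|>t$; $\Sigma_t=\mathbb{E}_t(\Theta\Theta^\top)$; $\operatorname{tr}$ is the trace. For a linear subspace $V$, $\mathbf{\Pi}_V^\perp$ is the orthogonal projection onto the orthogonal complement of $V$, and $R_t(V)=\mathbb{E}_t(\|\mathbf{\Pi}_V^\perp\Theta\|^2)$. $\mathcal{V}_p$ ($1\le p\le d$) is the set of $p$-dimensional linear subspaces of $\mathbb{R}^d$; $a\wedge b=\min(a,b)$. $X_1,\dots,X_n$ are i.i.d. copies of $X$, ordered as $\|X_{(1)}\|\ge\dots\ge\|X_{(n)}\|$; for $1\le k\le n-1$, $\hat t_{n,k}=\|X_{(k+1)}\|$ and $R_{n,k}(V)=\frac1k\sum_{i=1}^n\|\mathbf{\Pi}_V^\perp\theta(X_i)\|^2\mathbf{1}\{\|X_i\|>\hat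 t_{n,k}\}$. With $F_{\|X\|}$ the cumulative distribution function of $\|X\|$ and $F^\leftarrow_{\|X\|}$ its generalized inverse, $t_{n,k}=F^\leftarrow_{\|X\|}(1-k/n)$. Standing assumption: $F_{\|X\|}$ is continuous in the tail, i.e. it is continuous at every point of $[s_0,\infty)$ for some $s_0$, and $n,k$ are such that $t_{n,k}\ge s_0$. *)

theory Defs
  imports "HOL-Probability.Probability"
begin

section \<open>Regular variation\<close>

text \<open>
  The limit measure lives on the punctured space and, as usual for measures on the punctured
  space, is finite on all Borel sets bounded away from the origin. Without this requirement a
  measure charging every non-empty boundary, such as the counting measure, would satisfy the
  convergence condition vacuously for every random vector.
  For a set bounded away from the origin the boundary in the punctured space is
  the boundary in the whole space.
\<close>

definition bounded_away :: "'b::real_normed_vector set \<Rightarrow> bool" where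
  "bounded_away B \<longleftrightarrow> (\<exists>\<epsilon>>0. \<forall>x\<in>B. \<epsilon> \<le> norm x)"

definition regularly_varying :: "'a measure \<Rightarrow> ('a \<Rightarrow> 'b::euclidean_space) \<Rightarrow> bool" where
  "regularly_varying M X \<longleftrightarrow>
     (\<exists>(b :: real \<Rightarrow> real) (\<mu> :: 'b measure).
        (\<forall>t>0. b t > 0) \<and>
        sets \<mu> = sets (restrict_space borel (- {0})) \<and>
        emeasure \<mu> (space \<mu>) \<noteq> 0 \<and>
        (\<forall>B\<in>sets borel. bounded_away B \<longrightarrow> emeasure \<mu> B < \<infinity>) \<and>
        (\<forall>B\<in>sets borel. bounded_away B \<longrightarrow> emeasure \<mu> (frontier B) = 0 \<longrightarrow>
           ((\<lambda>t. measure M {\<xi> \<in> space M. X \<xi> \<in> (\<lambda>x. t *\<^sub>R x) ` B} / b t)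
              \<longlongrightarrow> measure \<mu> B) at_top))"

section \<open>Rescaling and conditioning on a large norm\<close>

definition rescale :: "('b::real_normed_vector \<Rightarrow> real) \<Rightarrow> 'b \<Rightarrow> 'b" where
  "rescale w x = (if x = 0 then 0 else w x *\<^sub>R x)"

definition exceedance :: "'a measure \<Rightarrow> ('a \<Rightarrow> 'b::real_normed_vector) \<Rightarrow> real \<Rightarrow> 'a set" where
  "exceedance M X t = {\<xi> \<in> space M. norm (X \<xi>) > t}"

definition exceed_prob :: "'a measure \<Rightarrow> ('a \<Rightarrow> 'b::real_normed_vector) \<Rightarrow> real \<Rightarrow> real" where
  "exceed_prob M X t = measure M (exceedance M X t)"

definition cond_expect ::
    "'a measure \<Rightarrow> ('a \<Rightarrow> 'b::real_normed_vector) \<Rightarrow> real \<Rightarrow>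
     ('a \<Rightarrow> 'c::{banach, second_countable_topology}) \<Rightarrow> 'c" where
  "cond_expect M X t f = integral\<^sup>L (uniform_measure M (exceedance M X t)) f"

definition cond_second_moment ::
    "'a measure \<Rightarrow> (real^'d \<Rightarrow> real) \<Rightarrow> ('a \<Rightarrow> real^'d) \<Rightarrow> real \<Rightarrow> real^'d^'d" where
  "cond_second_moment M w X t =
     cond_expect M X t (\<lambda>\<xi>. \<chi> i j. rescale w (X \<xi>) $ i * rescale w (X \<xi>) $ j)"

definition S_const ::
    "'a measure \<Rightarrow> (real^'d \<Rightarrow> real) \<Rightarrow> ('a \<Rightarrow> real^'d) \<Rightarrow> real \<Rightarrow> real" where
  "S_const M w X t =
     cond_expect M X t (\<lambda>\<xi>. norm (rescale w (X \<xi>)) ^ 4)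
     - exceed_prob M X t *
         trace (cond_second_moment M w X t ** cond_second_moment M w X t)"

section \<open>Projections and reconstruction risks\<close>

definition subspaces_of_dim :: "nat \<Rightarrow> 'b::euclidean_space set set" where
  "subspaces_of_dim p = {V. subspace V \<and> dim V = p}"

definition orth_proj :: "'b::euclidean_space set \<Rightarrow> 'b \<Rightarrow> 'b" where
  "orth_proj V x = (THE y. y \<in> V \<and> x - y \<in> orthogonal_comp V)"

definition risk ::
    "'a measure \<Rightarrow> ('b::euclidean_space \<Rightarrow> real) \<Rightarrow> ('a \<Rightarrow> 'b) \<Rightarrow> real \<Rightarrow> 'b set \<Rightarrow> real" where
  "risk M w X t V =
     cond_expect M X t (\<lambda>\<xi>. (norm (orth_proj (orthogonal_comp V) (rescale w (X \<xi>))))\<^sup>2)"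

text \<open>
  A sample of size \<open>n\<close> is a sequence of which only the entries with indices \<open>1, \<dots>, n\<close>
  matter. \<open>norm_order_stat x n j\<close> is the \<open>j\<close>-th largest of the \<open>n\<close> norms,
  counted with multiplicity, for \<open>1 \<le> j \<le> n\<close>.
\<close>

definition norm_order_stat :: "(nat \<Rightarrow> 'b::real_normed_vector) \<Rightarrow> nat \<Rightarrow> nat \<Rightarrow> real" where
  "norm_order_stat x n j = rev (sort (map (\<lambda>i. norm (x i)) [1..<Suc n])) ! (j - 1)"

definition emp_risk ::
    "('b::euclidean_space \<Rightarrow> real) \<Rightarrow> (nat \<Rightarrow> 'b) \<Rightarrow> nat \<Rightarrow> nat \<Rightarrow> 'b set \<Rightarrow> real" where
  "emp_risk w x n k V =
     1 / real k * (\<Sum>i=1..n. (norm (orth_proj (orthogonal_comp V) (rescale w (x i))))\<^sup>2 *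
       indicator {y. norm y > norm_order_stat x n (k + 1)} (x i))"

section \<open>Distribution of the norm\<close>

definition norm_cdf :: "'a measure \<Rightarrow> ('a \<Rightarrow> 'b::real_normed_vector) \<Rightarrow> real \<Rightarrow> real" where
  "norm_cdf M X = cdf (distr M borel (\<lambda>\<xi>. norm (X \<xi>)))"

definition gen_inverse :: "(real \<Rightarrow> real) \<Rightarrow> real \<Rightarrow> real" where
  "gen_inverse F q = Inf {x. q \<le> F x}"

definition tail_quantile ::
    "'a measure \<Rightarrow> ('a \<Rightarrow> 'b::real_normed_vector) \<Rightarrow> nat \<Rightarrow> nat \<Rightarrow> real" where
  "tail_quantile M X n k = gen_inverse (norm_cdf M X) (1 - real k / real n)"

definition max_deviation ::
    "'a measure \<Rightarrow> ('b::euclidean_space \<Rightarrow> real) \<Rightarrow> ('a \<Rightarrow> 'b) \<Rightarrow> (nat \<Rightarrow> 'b) \<Rightarrow>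
     nat \<Rightarrow> nat \<Rightarrow> nat \<Rightarrow> real" where
  "max_deviation M w X x n k p =
     (SUP V\<in>subspaces_of_dim p. \<bar>emp_risk w x n k V - risk M w X (tail_quantile M X n k) V\<bar>)"

end

theory Submission
  imports Defs
begin

text \<open>
  Let \<open>Q\<^sub>V\<close> be the matrix of the orthogonal projection onto the complement of \<open>V\<close>. Since
  \<open>\<parallel>Q\<^sub>V x\<parallel>\<^sup>2\<close> is the Frobenius inner product of \<open>Q\<^sub>V\<close> with the matrix \<open>x x\<^sup>T\<close>, all risks
  are linear functionals of second-moment matrices. Write \<open>t\<close> for the quantile threshold. Continuity
  of the tail gives \<open>P(\<parallel>X\<parallel> > t) = k/n\<close>, so the matrix \<open>D\<close> that results from averaging
  \<open>\<Theta> \<Theta>\<^sup>T\<close> over the sample points beyond \<open>t\<close>, with factor \<open>1/k\<close>, and subtracting \<open>\<Sigma>\<^sub>t\<close>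
  is centred.

  \<^emph>\<open>The random threshold.\<close> Let \<open>\<nu> = N/k - 1\<close>, where \<open>N\<close> points lie beyond \<open>t\<close>. At most \<open>k\<close> points
  lie beyond the empirical threshold, and almost surely exactly \<open>k\<close> of them if that threshold is at
  least \<open>t\<close>, because there are no ties in the continuous part of the tail. As every point contributes between
  \<open>0\<close> and \<open>1/k\<close> to the empirical risk, \<open>R\<^sub>n\<^sub>,\<^sub>k(V) - R\<^sub>t(V)\<close> lies between \<open>Q\<^sub>V \<bullet> D\<close> and
  \<open>Q\<^sub>V \<bullet> D - \<nu>\<close>. Hence the maximal deviation is almost surely at most the envelope
  \<open>W = sup\<^sub>V max \<bar>Q\<^sub>V \<bullet> D\<bar> \<bar>Q\<^sub>V \<bullet> D - \<nu>\<bar>\<close> (\<open>deviation_le_envelope\<close>).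

  \<^emph>\<open>Concentration.\<close> A point beyond \<open>t\<close> adds to \<open>k (Q\<^sub>V \<bullet> D)\<close> a number \<open>q\<close> in \<open>[0, 1]\<close> and to
  \<open>k (Q\<^sub>V \<bullet> D - \<nu>)\<close> the number \<open>q - 1\<close>; the other points add nothing. Replacing one point therefore
  moves \<open>W\<close> by at most \<open>1/k\<close>, and only if the old or the new point lies beyond \<open>t\<close>, an event of
  probability at most \<open>2 k/n\<close>. Integrating out one coordinate at a time, with the variance of each increment
  instead of its range, yields \<open>P(W \<ge> E W + s) \<le> exp (- k s\<^sup>2 / 4)\<close> for \<open>0 \<le> s \<le> 2\<close>
  (\<open>product_mgf_le_of_rare_variation\<close>, \<open>envelope_concentration\<close>).

  \<^emph>\<open>Mean.\<close> The Frobenius norms of \<open>Q\<^sub>V\<close> and \<open>1 - Q\<^sub>V\<close> are \<open>sqrt (d - p)\<close> and \<open>sqrt p\<close>, and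
  \<open>E \<parallel>D\<parallel>\<^sup>2 = S\<^sub>t / k\<close>. By Cauchy-Schwarz \<open>W\<close> is at most \<open>sqrt (d - p) \<parallel>D\<parallel> + \<bar>\<nu>\<bar>\<close>, and also at
  most \<open>sqrt p \<parallel>D\<parallel>\<close> plus the larger of \<open>\<bar>tr D\<bar>\<close> and \<open>\<bar>tr D - \<nu>\<bar>\<close>. The scalar terms have mean at
  most \<open>1 / sqrt k\<close> in both cases, so \<open>E W \<le> sqrt (min p (d - p) S\<^sub>t / k) + 1 / sqrt k\<close>
  (\<open>expectation_envelope_le\<close>).

  \<^emph>\<open>Conclusion.\<close> Put \<open>s = u + v\<close>. The maximal deviation never exceeds \<open>1\<close>, so only \<open>s \<le> 1\<close> matters.
  The surplus \<open>1 / sqrt k\<close> in the mean disappears in the constants, since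
  \<open>exp (- k (s - 1 / sqrt k)\<^sup>2 / 4) \<le> 2 exp (- k s\<^sup>2 / 8)\<close>; and as one of \<open>u\<close>, \<open>v\<close> is at most
  \<open>s / 2\<close>, the right-hand side is at most the larger of the two Bernstein terms of the claim. The
  bound with \<open>\<delta>\<close> is the case in which \<open>u\<close> and \<open>v\<close> make both exponents equal to \<open>ln (4 / \<delta>)\<close>.
\<close>

section \<open>Concentration of functions that rarely feel a change of one coordinate\<close>

lemma exp_le_quadratic:
  fixes y :: real
  assumes "y \<le> 1"
  shows "exp y \<le> 1 + y + y\<^sup>2"
proof (cases "0 \<le> y")
  case True
  then show ?thesis using exp_bound assms by simp
next
  case False
  have "0 < 1 - y" using False by simp
  have "1 - y \<le> exp (- y)" using exp_ge_add_one_self[of "- y"] by simp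
  then have "exp y \<le> 1 / (1 - y)"
    using \<open>0 < 1 - y\<close> by (simp add: exp_minus field_simps)
  also have "\<dots> \<le> 1 + y + y\<^sup>2"
  proof -
    have "(1 + y + y\<^sup>2) * (1 - y) = 1 - y ^ 3"
      by (simp add: algebra_simps power2_eq_square power3_eq_cube)
    moreover have "y ^ 3 \<le> 0" using False by (simp add: power_le_zero_eq)
    ultimately show ?thesis using \<open>0 < 1 - y\<close> by (simp add: divide_le_eq)
  qed
  finally show ?thesis .
qed

text \<open>
  The second-order expansion of the exponential reduces the claim to a bound on the variance of \<open>g\<close>,
  and the variance is at most the mean square distance of \<open>g\<close> from the constant value that it takes off \<open>A\<close>.
\<close>
lemma (in prob_space) centred_mgf_le_of_rare_variation:
  fixes g :: "'a \<Rightarrow> real"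
  assumes [measurable]: "g \<in> borel_measurable M" "A \<in> sets M"
    and osc: "\<And>x y. x \<in> space M \<Longrightarrow> y \<in> space M \<Longrightarrow>
                \<bar>g x - g y\<bar> \<le> c * max (indicator A x) (indicator A y)"
    and c: "0 \<le> c" and l: "0 \<le> l" "l * c \<le> 1"
  shows "expectation (\<lambda>x. exp (l * (g x - expectation g))) \<le> exp (l\<^sup>2 * c\<^sup>2 * prob A)"
proof -
  obtain x1 where x1: "x1 \<in> space M" using not_empty by auto
  have osc1: "\<bar>g x - g y\<bar> \<le> c" if "x \<in> space M" "y \<in> space M" for x y
    using osc[OF that] c by (cases "x \<in> A \<or> y \<in> A") auto
  have int_g: "integrable M g"
    by (rule integrable_const_bound[of _ "\<bar>g x1\<bar> + c"]) (use osc1 x1 in \<open>force intro!: AE_I2\<close>)+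
  have dev: "\<bar>g x - expectation g\<bar> \<le> c" if "x \<in> space M" for x
  proof -
    have "expectation g \<le> g x + c"
      by (rule integral_le_const[OF int_g]) (use osc1 that in \<open>force intro!: AE_I2\<close>)
    moreover have "g x - c \<le> expectation g"
      by (rule integral_ge_const[OF int_g]) (use osc1 that in \<open>force intro!: AE_I2\<close>)
    ultimately show ?thesis by linarith
  qed
  define Y where "Y x = l * (g x - expectation g)" for x
  have Y1: "\<bar>Y x\<bar> \<le> 1" if "x \<in> space M" for x
    using dev[OF that] l mult_left_mono[OF dev[OF that] l(1)] by (simp add: Y_def abs_mult)
  have [measurable]: "Y \<in> borel_measurable M" unfolding Y_def by measurable
  have int_Y: "integrable M Y" unfolding Y_def using int_g by simp
  have int_Y2: "integrable M (\<lambda>x. (Y x)\<^sup>2)"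
    by (rule integrable_const_bound[of _ 1]) (use Y1 in \<open>auto intro!: AE_I2 simp: abs_square_le_1\<close>)
  have EY: "expectation Y = 0" unfolding Y_def using int_g prob_space by simp
  \<comment> \<open>Off \<open>A\<close> the function \<open>g\<close> is constant; \<open>m\<close> is that constant.\<close>
  obtain x0 where x0: "x0 \<in> space M" "\<And>x. x \<in> space M \<Longrightarrow> x \<notin> A \<Longrightarrow> x0 \<notin> A"
    using x1 by (cases "\<exists>x\<in>space M. x \<notin> A") auto
  define m where "m = g x0"
  have near: "\<bar>g x - m\<bar> \<le> c * indicator A x" if "x \<in> space M" for x
    using osc[OF that x0(1)] x0 osc1[OF that x0(1)] that by (cases "x \<in> A") (auto simp: m_def)
  have "expectation (\<lambda>x. (Y x)\<^sup>2) \<le> l\<^sup>2 * c\<^sup>2 * prob A"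
  proof -
    have int2: "integrable M (\<lambda>x. (g x - m)\<^sup>2)"
      by (rule integrable_const_bound[of _ "c\<^sup>2"])
         (use osc1 x0(1) c in \<open>auto intro!: AE_I2 simp: m_def power2_le_iff_abs_le\<close>)
    have eq: "(Y x)\<^sup>2 = l\<^sup>2 * (g x - m)\<^sup>2 - 2 * l * (expectation g - m) * Y x - l\<^sup>2 * (expectation g - m)\<^sup>2" for x
      unfolding Y_def by (simp add: power2_eq_square algebra_simps)
    have "expectation (\<lambda>x. (Y x)\<^sup>2) = l\<^sup>2 * expectation (\<lambda>x. (g x - m)\<^sup>2) - l\<^sup>2 * (expectation g - m)\<^sup>2"
      unfolding eq using int2 int_Y EY prob_space by simp
    also have "\<dots> \<le> l\<^sup>2 * expectation (\<lambda>x. (g x - m)\<^sup>2)" by simp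
    also have "expectation (\<lambda>x. (g x - m)\<^sup>2) \<le> expectation (\<lambda>x. c\<^sup>2 * indicator A x)"
    proof (rule integral_mono[OF int2])
      show "integrable M (\<lambda>x. c\<^sup>2 * indicator A x)"
        using integrable_real_indicator[of A M] by (simp add: emeasure_eq_measure)
      show "(g x - m)\<^sup>2 \<le> c\<^sup>2 * indicator A x" if "x \<in> space M" for x
        using near[OF that] c by (auto simp: indicator_def power2_le_iff_abs_le split: if_splits)
    qed
    also have "\<dots> = c\<^sup>2 * prob A" by simp
    finally show ?thesis by (simp add: mult.assoc mult_left_mono)
  qed
  moreover have "expectation (\<lambda>x. exp (Y x)) \<le> expectation (\<lambda>x. 1 + Y x + (Y x)\<^sup>2)"
  proof (rule integral_mono)
    show "integrable M (\<lambda>x. exp (Y x))"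
      by (rule integrable_const_bound[of _ "exp 1"]) (use Y1 in \<open>force intro!: AE_I2\<close>)+
    show "integrable M (\<lambda>x. 1 + Y x + (Y x)\<^sup>2)" using int_Y int_Y2 by simp
    show "exp (Y x) \<le> 1 + Y x + (Y x)\<^sup>2" if "x \<in> space M" for x
      using Y1[OF that] by (intro exp_le_quadratic) auto
  qed
  moreover have "expectation (\<lambda>x. 1 + Y x + (Y x)\<^sup>2) = 1 + expectation (\<lambda>x. (Y x)\<^sup>2)"
    using int_Y int_Y2 EY prob_space by simp
  moreover have "1 + l\<^sup>2 * c\<^sup>2 * prob A \<le> exp (l\<^sup>2 * c\<^sup>2 * prob A)"
    by (rule exp_ge_add_one_self)
  ultimately show ?thesis unfolding Y_def by linarith
qed

text \<open>
  A martingale argument in the form of an induction over the coordinates: averaging \<open>f\<close> over one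
  coordinate leaves a function of the other coordinates with the same oscillation property, and the
  one-coordinate bound controls what the averaging loses. The exponent carries the variance
  \<open>c\<^sup>2 N(A)\<close> per coordinate where the bounded-difference inequality would have a multiple of \<open>c\<^sup>2\<close>.
\<close>
lemma product_mgf_le_of_rare_variation:
  fixes f :: "('i \<Rightarrow> 'b) \<Rightarrow> real"
  assumes N: "prob_space N" and A: "A \<in> sets N"
    and c: "0 \<le> c" and l: "0 \<le> l" "l * c \<le> 1"
    and I: "finite I"
    and f: "f \<in> borel_measurable (PiM I (\<lambda>_. N))"
    and bounded: "\<And>x. x \<in> space (PiM I (\<lambda>_. N)) \<Longrightarrow> \<bar>f x\<bar> \<le> B"
    and osc: "\<And>i x y. i \<in> I \<Longrightarrow> x \<in> space (PiM I (\<lambda>_. N)) \<Longrightarrow> y \<in> space N \<Longrightarrow>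
                \<bar>f x - f (x(i := y))\<bar> \<le> c * max (indicator A (x i)) (indicator A y)"
  shows "(\<integral>x. exp (l * (f x - integral\<^sup>L (PiM I (\<lambda>_. N)) f)) \<partial>PiM I (\<lambda>_. N))
           \<le> exp (real (card I) * (l\<^sup>2 * c\<^sup>2 * measure N A))"
  using I f bounded osc
proof (induction I arbitrary: f rule: finite_induct)
  case empty
  interpret product_sigma_finite "\<lambda>_. N"
    by (simp add: N prob_space_imp_sigma_finite product_sigma_finite_def)
  show ?case by (simp add: PiM_empty lebesgue_integral_count_space_finite)
next
  case (insert i I f)
  interpret N: prob_space N by (rule N)
  interpret product_sigma_finite "\<lambda>_. N"
    by (simp add: N.sigma_finite_measure_axioms product_sigma_finite_def)
  let ?P = "PiM I (\<lambda>_. N)" and ?P' = "PiM (insert i I) (\<lambda>_. N)"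
  interpret P: prob_space ?P by (rule prob_space_PiM) (rule N)
  interpret P': prob_space ?P' by (rule prob_space_PiM) (rule N)
  have [measurable]: "f \<in> borel_measurable ?P'" by (rule insert.prems(1))
  have upd: "x(i := y) \<in> space ?P'" if "x \<in> space ?P" "y \<in> space N" for x y
    using that by (auto simp: space_PiM PiE_iff extensional_def)
  have upd_meas: "(\<lambda>(x, y). x(i := y)) \<in> measurable (?P \<Otimes>\<^sub>M N) ?P'"
    by (rule measurable_add_dim)
  have f_upd [measurable]: "(\<lambda>(x, y). f (x(i := y))) \<in> borel_measurable (?P \<Otimes>\<^sub>M N)"
    using measurable_comp[OF upd_meas insert.prems(1)] by (simp add: comp_def case_prod_beta')
  have f_sec: "(\<lambda>y. f (x(i := y))) \<in> borel_measurable N" if "x \<in> space ?P" for x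
    using measurable_Pair2[OF f_upd that] by simp
  have int_sec: "integrable N (\<lambda>y. f (x(i := y)))" if "x \<in> space ?P" for x
    by (rule N.integrable_const_bound[of _ B])
       (use f_sec[OF that] insert.prems(2) upd[OF that] in \<open>auto intro!: AE_I2\<close>)
  define h where "h x = (\<integral>y. f (x(i := y)) \<partial>N)" for x
  have h_meas [measurable]: "h \<in> borel_measurable ?P"
    unfolding h_def using f_upd by (rule N.borel_measurable_lebesgue_integral)
  have h_bd: "\<bar>h x\<bar> \<le> B" if "x \<in> space ?P" for x
  proof -
    have "h x \<le> B" unfolding h_def
      by (rule N.integral_le_const[OF int_sec[OF that]]) (rule AE_I2, use abs_le_D1[OF insert.prems(2)[OF upd[OF that]]] in \<open>simp add: fun_upd_def\<close>)
    moreover have "- B \<le> h x" unfolding h_def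
      by (rule N.integral_ge_const[OF int_sec[OF that]]) (rule AE_I2, use abs_le_D2[OF insert.prems(2)[OF upd[OF that]]] in \<open>simp add: fun_upd_def minus_le_iff\<close>)
    ultimately show ?thesis by linarith
  qed
  have int_f: "integrable ?P' f"
    by (rule P'.integrable_const_bound[of _ B]) (use insert.prems(2) in \<open>auto intro!: AE_I2\<close>)
  have Ef: "integral\<^sup>L ?P' f = integral\<^sup>L ?P h"
    unfolding h_def by (rule product_integral_insert[OF insert.hyps(1,2) int_f])
  define e where "e = integral\<^sup>L ?P h"
  have IH: "(\<integral>x. exp (l * (h x - e)) \<partial>?P) \<le> exp (real (card I) * (l\<^sup>2 * c\<^sup>2 * measure N A))"
    unfolding e_def
  proof (rule insert.IH[OF h_meas h_bd])
    fix j x y assume j: "j \<in> I" and x: "x \<in> space ?P" and y: "y \<in> space N"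
    have xj: "x(j := y) \<in> space ?P" using x y j by (auto simp: space_PiM PiE_iff extensional_def)
    have "\<bar>h x - h (x(j := y))\<bar> = \<bar>\<integral>z. f (x(i := z)) - f ((x(j := y))(i := z)) \<partial>N\<bar>"
      unfolding h_def using int_sec[OF x] int_sec[OF xj] by simp
    also have "\<dots> \<le> (\<integral>z. \<bar>f (x(i := z)) - f ((x(j := y))(i := z))\<bar> \<partial>N)"
      by (rule integral_abs_bound)
    also have "\<dots> \<le> c * max (indicator A (x j)) (indicator A y)"
    proof (rule N.integral_le_const)
      show "integrable N (\<lambda>z. \<bar>f (x(i := z)) - f ((x(j := y))(i := z))\<bar>)"
        using int_sec[OF x] int_sec[OF xj] by simp
      show "AE z in N. \<bar>f (x(i := z)) - f ((x(j := y))(i := z))\<bar> \<le> c * max (indicator A (x j)) (indicator A y)"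
      proof (rule AE_I2)
        fix z assume z: "z \<in> space N"
        have "i \<noteq> j" using j insert.hyps(2) by auto
        then have eqs: "(x(j := y))(i := z) = (x(i := z))(j := y)" "(x(i := z)) j = x j"
          by (auto simp: fun_upd_twist)
        show "\<bar>f (x(i := z)) - f ((x(j := y))(i := z))\<bar> \<le> c * max (indicator A (x j)) (indicator A y)"
          using insert.prems(3)[OF insertI2[OF j] upd[OF x z] y] unfolding eqs .
      qed
    qed
    finally show "\<bar>h x - h (x(j := y))\<bar> \<le> c * max (indicator A (x j)) (indicator A y)" .
  qed
  have e_bd: "\<bar>e\<bar> \<le> B"
    unfolding e_def
  proof -
    have "integrable ?P h"
      by (rule P.integrable_const_bound[of _ B]) (use h_bd in \<open>auto intro!: AE_I2\<close>)
    then have "integral\<^sup>L ?P h \<le> B" "- B \<le> integral\<^sup>L ?P h"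
      by (intro P.integral_le_const P.integral_ge_const, auto intro!: AE_I2 dest: h_bd)+
    then show "\<bar>integral\<^sup>L ?P h\<bar> \<le> B" by linarith
  qed
  have ebd: "\<bar>exp (l * (z - e))\<bar> \<le> exp (l * (2 * B))" if "\<bar>z\<bar> \<le> B" for z
    using that e_bd l(1) by (auto intro!: mult_left_mono)
  have step: "(\<integral>y. exp (l * (f (x(i := y)) - e)) \<partial>N)
      \<le> exp (l * (h x - e)) * exp (l\<^sup>2 * c\<^sup>2 * measure N A)" if x: "x \<in> space ?P" for x
  proof -
    have "(\<integral>y. exp (l * (f (x(i := y)) - e)) \<partial>N)
        = (\<integral>y. exp (l * (h x - e)) * exp (l * (f (x(i := y)) - h x)) \<partial>N)"
      by (simp add: algebra_simps flip: exp_add)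
    also have "\<dots> = exp (l * (h x - e)) * (\<integral>y. exp (l * (f (x(i := y)) - h x)) \<partial>N)"
      by simp
    also have "(\<integral>y. exp (l * (f (x(i := y)) - h x)) \<partial>N) \<le> exp (l\<^sup>2 * c\<^sup>2 * measure N A)"
      unfolding h_def
    proof (rule N.centred_mgf_le_of_rare_variation[OF f_sec[OF x] A _ c l])
      fix y z assume "y \<in> space N" "z \<in> space N"
      then show "\<bar>f (x(i := y)) - f (x(i := z))\<bar> \<le> c * max (indicator A y) (indicator A z)"
        using insert.prems(3)[OF insertI1 upd[OF x]] by (simp only: fun_upd_upd fun_upd_same)
    qed
    finally show ?thesis by simp
  qed
  have int_exp: "integrable ?P' (\<lambda>x. exp (l * (f x - e)))"
    by (rule P'.integrable_const_bound[of _ "exp (l * (2 * B))"])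
       (use insert.prems(2) ebd in \<open>auto intro!: AE_I2\<close>)
  have meas_in: "(\<lambda>x. \<integral>y. exp (l * (f (x(i := y)) - e)) \<partial>N) \<in> borel_measurable ?P"
    by (rule N.borel_measurable_lebesgue_integral) (use f_upd in measurable)
  have int_exph: "integrable ?P (\<lambda>x. exp (l * (h x - e)))"
    by (rule P.integrable_const_bound[of _ "exp (l * (2 * B))"])
       (use h_bd ebd in \<open>auto intro!: AE_I2\<close>)
  have "(\<integral>x. exp (l * (f x - integral\<^sup>L ?P' f)) \<partial>?P')
      = (\<integral>x. (\<integral>y. exp (l * (f (x(i := y)) - e)) \<partial>N) \<partial>?P)"
    unfolding Ef e_def[symmetric] by (rule product_integral_insert[OF insert.hyps(1,2) int_exp])
  also have "\<dots> \<le> (\<integral>x. exp (l * (h x - e)) * exp (l\<^sup>2 * c\<^sup>2 * measure N A) \<partial>?P)"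
  proof (rule integral_mono_AE')
    show "integrable ?P (\<lambda>x. exp (l * (h x - e)) * exp (l\<^sup>2 * c\<^sup>2 * measure N A))"
      using int_exph by simp
  qed (use step in \<open>auto intro!: AE_I2\<close>)
  also have "\<dots> \<le> exp (real (card I) * (l\<^sup>2 * c\<^sup>2 * measure N A)) * exp (l\<^sup>2 * c\<^sup>2 * measure N A)"
    using IH by simp
  also have "\<dots> = exp (real (card (insert i I)) * (l\<^sup>2 * c\<^sup>2 * measure N A))"
    using insert.hyps by (simp add: algebra_simps flip: exp_add)
  finally show ?case .
qed

lemma (in prob_space) concentration_of_rare_variation:
  fixes f :: "('i \<Rightarrow> 'b) \<Rightarrow> real"
  assumes indep: "indep_vars (\<lambda>_. L) Z I" and law: "\<And>i. i \<in> I \<Longrightarrow> distr M L (Z i) = N"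
    and I: "finite I" "I \<noteq> {}" and A: "A \<in> sets L"
    and f: "f \<in> borel_measurable (PiM I (\<lambda>_. L))"
    and bounded: "\<And>x. x \<in> space (PiM I (\<lambda>_. L)) \<Longrightarrow> \<bar>f x\<bar> \<le> B"
    and osc: "\<And>i x y. i \<in> I \<Longrightarrow> x \<in> space (PiM I (\<lambda>_. L)) \<Longrightarrow> y \<in> space L \<Longrightarrow>
                \<bar>f x - f (x(i := y))\<bar> \<le> c * max (indicator A (x i)) (indicator A y)"
    and c: "0 \<le> c" and l: "0 \<le> l" "l * c \<le> 1"
  shows "prob {\<xi> \<in> space M. f (\<lambda>i\<in>I. Z i \<xi>) \<ge> expectation (\<lambda>\<xi>. f (\<lambda>i\<in>I. Z i \<xi>)) + s}
           \<le> exp (real (card I) * (l\<^sup>2 * c\<^sup>2 * measure N A) - l * s)"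
proof -
  let ?J = "PiM I (\<lambda>_. L)" and ?T = "\<lambda>\<xi>. \<lambda>i\<in>I. Z i \<xi>"
  have rv: "Z i \<in> measurable M L" if "i \<in> I" for i
    using indep that by (auto simp: indep_vars_def)
  have [measurable]: "?T \<in> measurable M ?J" by (rule measurable_restrict) (rule rv)
  have setsN: "sets N = sets L" and N: "prob_space N"
  proof -
    obtain i where i: "i \<in> I" using I(2) by auto
    show "sets N = sets L" using law[OF i] by (metis sets_distr)
    show "prob_space N" using law[OF i] prob_space_distr[OF rv[OF i]] by simp
  qed
  have joint: "distr M ?J ?T = PiM I (\<lambda>_. N)"
  proof -
    have "distr M ?J ?T = PiM I (\<lambda>i. distr M L (Z i))"
      using indep_vars_iff_distr_eq_PiM'[OF I(2), of Z "\<lambda>_. L"] rv indep by blast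
    then show ?thesis using law by (simp cong: PiM_cong)
  qed
  have setsJ: "sets (PiM I (\<lambda>_. N)) = sets ?J"
    by (intro sets_PiM_cong) (simp_all add: setsN)
  note spaceJ = sets_eq_imp_space_eq[OF setsJ] and spaceN = sets_eq_imp_space_eq[OF setsN]
  have fN: "f \<in> borel_measurable (PiM I (\<lambda>_. N))"
    using f measurable_cong_sets[OF setsJ refl, of borel] by auto
  have E: "(\<integral>x. g x \<partial>PiM I (\<lambda>_. N)) = expectation (\<lambda>\<xi>. g (?T \<xi>))" if "g \<in> borel_measurable ?J" for g :: "_ \<Rightarrow> real"
    unfolding joint[symmetric] by (rule integral_distr) (use that in auto)
  define e where "e = expectation (\<lambda>\<xi>. f (?T \<xi>))"
  have Ee: "integral\<^sup>L (PiM I (\<lambda>_. N)) f = e" unfolding e_def by (rule E[OF f])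
  have mgf: "expectation (\<lambda>\<xi>. exp (l * (f (?T \<xi>) - e))) \<le> exp (real (card I) * (l\<^sup>2 * c\<^sup>2 * measure N A))"
  proof -
    have "(\<integral>x. exp (l * (f x - e)) \<partial>PiM I (\<lambda>_. N)) \<le> exp (real (card I) * (l\<^sup>2 * c\<^sup>2 * measure N A))"
      unfolding Ee[symmetric]
      by (rule product_mgf_le_of_rare_variation[OF N _ c l I(1) fN, of A B])
         (use A bounded osc in \<open>auto simp: setsN spaceJ spaceN\<close>)
    then show ?thesis using f by (subst (asm) E) auto
  qed
  have [measurable]: "(\<lambda>\<xi>. f (?T \<xi>)) \<in> borel_measurable M"
    using measurable_compose[OF \<open>?T \<in> measurable M ?J\<close> f] .
  have "integrable M (\<lambda>\<xi>. exp (l * (f (?T \<xi>) - e)))"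
  proof (rule integrable_const_bound[of _ "exp (l * (B - e))"])
    show "AE \<xi> in M. norm (exp (l * (f (?T \<xi>) - e))) \<le> exp (l * (B - e))"
    proof (rule AE_I2)
      fix \<xi> assume "\<xi> \<in> space M"
      then have "?T \<xi> \<in> space ?J" using \<open>?T \<in> measurable M ?J\<close> by (auto simp: measurable_def)
      then have "f (?T \<xi>) \<le> B" using bounded by force
      then show "norm (exp (l * (f (?T \<xi>) - e))) \<le> exp (l * (B - e))"
        using l(1) by (auto intro!: mult_left_mono)
    qed
  qed simp
  then have "prob {\<xi> \<in> space M. exp (l * s) \<le> exp (l * (f (?T \<xi>) - e))}
      \<le> expectation (\<lambda>\<xi>. exp (l * (f (?T \<xi>) - e))) / exp (l * s)"
    by (intro integral_Markov_inequality_measure[where A = "{}"]) auto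
  also have "\<dots> \<le> exp (real (card I) * (l\<^sup>2 * c\<^sup>2 * measure N A)) / exp (l * s)"
    using mgf by (simp add: divide_right_mono)
  also have "\<dots> = exp (real (card I) * (l\<^sup>2 * c\<^sup>2 * measure N A) - l * s)" by (simp add: exp_diff)
  finally have "prob {\<xi> \<in> space M. exp (l * s) \<le> exp (l * (f (?T \<xi>) - e))} \<le> \<dots>" .
  moreover have "prob {\<xi> \<in> space M. f (?T \<xi>) \<ge> e + s}
      \<le> prob {\<xi> \<in> space M. exp (l * s) \<le> exp (l * (f (?T \<xi>) - e))}"
    by (rule finite_measure_mono) (use l(1) in \<open>auto intro!: mult_left_mono\<close>)
  ultimately show ?thesis unfolding e_def by linarith
qed

section \<open>Risks as linear functionals of second-moment matrices\<close>

definition outer :: "real^'d \<Rightarrow> real^'d^'d" where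
  "outer x = (\<chi> i j. x $ i * x $ j)"

lemma inner_outer_outer: "outer x \<bullet> outer y = (x \<bullet> y)\<^sup>2"
  by (simp add: outer_def inner_vec_def power2_eq_square sum_product mult_ac)

lemma norm_outer: "norm (outer x) = (norm x)\<^sup>2"
  by (simp add: norm_eq_sqrt_inner inner_outer_outer power2_norm_eq_inner)

lemma mat_1_inner_outer: "mat 1 \<bullet> outer x = (norm x)\<^sup>2"
  unfolding mat_def outer_def inner_vec_def power2_norm_eq_inner
  by (simp add: if_distrib[of "\<lambda>u. u * _"] sum.delta cong: if_cong)

lemma outer_measurable [measurable]: "outer \<in> borel_measurable borel"
  unfolding outer_def by (intro borel_measurable_continuous_onI continuous_intros)

text \<open>
  The matrix of the orthogonal projection onto the complement of \<open>V\<close>, built from some orthonormal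
  basis of \<open>V\<close>. A basis of \<open>V\<close> rather than of its complement gives the norms of both projections
  from one computation.
\<close>
definition compl_proj_mat :: "(real^'d) set \<Rightarrow> real^'d^'d" where
  "compl_proj_mat V = mat 1 - (\<Sum>b\<in>(SOME B. B \<subseteq> V \<and> pairwise orthogonal B \<and> (\<forall>b\<in>B. norm b = 1) \<and>
      independent B \<and> card B = dim V \<and> span B = V). outer b)"

lemma compl_proj_mat_eq:
  fixes V :: "(real^'d) set"
  assumes "subspace V"
  obtains B where "B \<subseteq> V" "finite B" "pairwise orthogonal B" "\<And>b. b \<in> B \<Longrightarrow> norm b = 1"
    "card B = dim V" "span B = V" "compl_proj_mat V = mat 1 - (\<Sum>b\<in>B. outer b)"
proof -
  let ?Q = "\<lambda>B. B \<subseteq> V \<and> pairwise orthogonal B \<and> (\<forall>b\<in>B. norm b = 1) \<and>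
      independent B \<and> card B = dim V \<and> span B = V"
  have "\<exists>B. ?Q B"
    by (rule orthonormal_basis_subspace[OF assms]) blast
  then have "?Q (SOME B. ?Q B)" by (rule someI_ex)
  then show ?thesis
    by (intro that[of "SOME B. ?Q B"]) (auto simp: compl_proj_mat_def independent_imp_finite)
qed

lemma inner_orthonormal_expansion:
  fixes B :: "'b::euclidean_space set"
  assumes B: "finite B" "pairwise orthogonal B" "\<And>b. b \<in> B \<Longrightarrow> norm b = 1" and b: "b \<in> B"
  shows "b \<bullet> (\<Sum>c\<in>B. (c \<bullet> x) *\<^sub>R c) = b \<bullet> x"
proof -
  have "b \<bullet> (\<Sum>c\<in>B. (c \<bullet> x) *\<^sub>R c) = (\<Sum>c\<in>B. if c = b then b \<bullet> x else 0)"
    unfolding inner_sum_right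
    by (rule sum.cong) (use B(2,3) b in \<open>auto simp: pairwise_def orthogonal_def norm_eq_1\<close>)
  then show ?thesis using B(1) b by simp
qed

lemma orth_proj_orthogonal_comp_eq:
  fixes V :: "(real^'d) set"
  assumes B: "finite B" "pairwise orthogonal B" "\<And>b. b \<in> B \<Longrightarrow> norm b = 1" "span B = V"
  shows "orth_proj (orthogonal_comp V) x = x - (\<Sum>b\<in>B. (b \<bullet> x) *\<^sub>R b)"
proof -
  let ?z = "\<Sum>b\<in>B. (b \<bullet> x) *\<^sub>R b"
  have sV: "subspace V" using B(4) by (metis subspace_span)
  have z: "?z \<in> V" using B(4) by (metis (no_types, lifting) span_base span_mul span_sum)
  have bz: "b \<bullet> ?z = b \<bullet> x" if "b \<in> B" for b
    by (rule inner_orthonormal_expansion[OF B(1-3) that])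
  have perp: "x - ?z \<in> orthogonal_comp V"
  proof -
    have "orthogonal (x - ?z) b" if "b \<in> B" for b
      using bz[OF that] by (simp add: orthogonal_def inner_commute[of _ b] inner_diff_right)
    then have "orthogonal (x - ?z) v" if "v \<in> V" for v
      using orthogonal_to_span[of v B "x - ?z"] that B(4) by blast
    then show ?thesis by (auto simp: orthogonal_comp_def orthogonal_commute)
  qed
  show ?thesis
    unfolding orth_proj_def orthogonal_comp_self[OF sV]
  proof (rule the_equality)
    show "x - ?z \<in> orthogonal_comp V \<and> x - (x - ?z) \<in> V" using perp z by simp
    fix y assume y: "y \<in> orthogonal_comp V \<and> x - y \<in> V"
    have "y - (x - ?z) \<in> orthogonal_comp V"
      using y perp subspace_diff[OF subspace_orthogonal_comp] by blast
    moreover have "y - (x - ?z) = ?z - (x - y)" by simp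
    moreover have "?z - (x - y) \<in> V"
      using subspace_diff[OF sV z conjunct2[OF y]] .
    ultimately have "orthogonal (y - (x - ?z)) (y - (x - ?z))"
      unfolding orthogonal_comp_def by (metis (mono_tags, lifting) mem_Collect_eq)
    then show "y = x - ?z" by (simp add: orthogonal_self)
  qed
qed

lemma compl_proj_mat_inner_outer:
  fixes V :: "(real^'d) set"
  assumes "subspace V"
  shows "compl_proj_mat V \<bullet> outer x = (norm (orth_proj (orthogonal_comp V) x))\<^sup>2"
proof -
  obtain B where B: "finite B" "pairwise orthogonal B" "\<And>b. b \<in> B \<Longrightarrow> norm b = 1" "span B = V"
    "compl_proj_mat V = mat 1 - (\<Sum>b\<in>B. outer b)"
    using compl_proj_mat_eq[OF assms] by metis
  let ?z = "\<Sum>b\<in>B. (b \<bullet> x) *\<^sub>R b"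
  have zz: "?z \<bullet> ?z = (\<Sum>b\<in>B. (b \<bullet> x)\<^sup>2)"
  proof -
    have "c \<bullet> ?z = c \<bullet> x" if "c \<in> B" for c
      by (rule inner_orthonormal_expansion[OF B(1-3) that])
    then show ?thesis by (simp add: inner_sum_left power2_eq_square)
  qed
  have xz: "x \<bullet> ?z = (\<Sum>b\<in>B. (b \<bullet> x)\<^sup>2)"
    by (simp add: inner_sum_right power2_eq_square inner_commute)
  have "(norm (x - ?z))\<^sup>2 = (norm x)\<^sup>2 - (\<Sum>b\<in>B. (b \<bullet> x)\<^sup>2)"
    unfolding power2_norm_eq_inner using zz xz
    by (simp add: inner_diff_left inner_diff_right inner_commute)
  moreover have "orth_proj (orthogonal_comp V) x = x - ?z"
    by (rule orth_proj_orthogonal_comp_eq[OF B(1-4)])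
  ultimately show ?thesis
    unfolding B(5)
    by (simp add: inner_diff_left inner_sum_left mat_1_inner_outer inner_outer_outer)
qed

lemma norm_proj_mats:
  fixes V :: "(real^'d) set"
  assumes "subspace V"
  shows "norm (compl_proj_mat V) = sqrt (real (CARD('d) - dim V))"
    and "norm (mat 1 - compl_proj_mat V) = sqrt (real (dim V))"
proof -
  obtain B where B: "finite B" "pairwise orthogonal B" "\<And>b. b \<in> B \<Longrightarrow> norm b = 1" "card B = dim V"
    "compl_proj_mat V = mat 1 - (\<Sum>b\<in>B. outer b)"
    using compl_proj_mat_eq[OF assms] by metis
  let ?P = "\<Sum>b\<in>B. outer b"
  have PP: "?P \<bullet> ?P = real (dim V)"
  proof -
    have "outer b \<bullet> ?P = 1" if "b \<in> B" for b
    proof -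
      have "outer b \<bullet> ?P = (\<Sum>c\<in>B. if c = b then 1 else 0)"
        unfolding inner_sum_right
        by (rule sum.cong)
           (use B(2,3) that in \<open>auto simp: inner_outer_outer pairwise_def orthogonal_def norm_eq_1\<close>)
      then show ?thesis using B(1) that by simp
    qed
    then show ?thesis using B(4) by (simp add: inner_sum_left)
  qed
  have IP: "mat 1 \<bullet> ?P = real (dim V)"
    using B(3,4) by (simp add: inner_sum_right mat_1_inner_outer)
  have II: "(mat 1 :: real^'d^'d) \<bullet> mat 1 = real CARD('d)"
    unfolding mat_def inner_vec_def
    by (simp add: if_distrib[of "\<lambda>u. u * _"] sum.delta cong: if_cong)
  have "dim V \<le> CARD('d)" using dim_subset_UNIV_cart by blast
  then show "norm (compl_proj_mat V) = sqrt (real (CARD('d) - dim V))"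
    unfolding B(5) norm_eq_sqrt_inner
    using PP IP II by (simp add: inner_diff_left inner_diff_right inner_commute of_nat_diff)
  show "norm (mat 1 - compl_proj_mat V) = sqrt (real (dim V))"
    unfolding B(5) norm_eq_sqrt_inner using PP by simp
qed

lemma compl_proj_mat_inner_outer_bounds:
  fixes V :: "(real^'d) set"
  assumes "subspace V"
  shows "0 \<le> compl_proj_mat V \<bullet> outer x" "compl_proj_mat V \<bullet> outer x \<le> (norm x)\<^sup>2"
proof -
  show "0 \<le> compl_proj_mat V \<bullet> outer x"
    unfolding compl_proj_mat_inner_outer[OF assms] by simp
  obtain B where B: "compl_proj_mat V = mat 1 - (\<Sum>b\<in>B. outer b)"
    using compl_proj_mat_eq[OF assms] by metis
  have "0 \<le> (\<Sum>b\<in>B. outer b \<bullet> outer x)" by (intro sum_nonneg) (simp add: inner_outer_outer)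
  then show "compl_proj_mat V \<bullet> outer x \<le> (norm x)\<^sup>2"
    by (simp add: B inner_diff_left inner_sum_left mat_1_inner_outer)
qed

text \<open>
  The parameter \<open>\<nu>\<close> shifts all risks by one scalar; it will account for the fluctuation of the
  number of points beyond the threshold.
\<close>
definition risk_sup :: "nat \<Rightarrow> real^'d^'d \<Rightarrow> real \<Rightarrow> real" where
  "risk_sup p D \<nu> = (SUP V\<in>subspaces_of_dim p. \<bar>compl_proj_mat V \<bullet> D - \<nu>\<bar>)"

lemma subspaces_of_dim_nonempty:
  assumes "p \<le> CARD('d)"
  shows "(subspaces_of_dim p :: (real^'d) set set) \<noteq> {}"
proof -
  have "p \<le> dim (UNIV :: (real^'d) set)" using assms by simp
  then obtain T :: "(real^'d) set" where "subspace T" "dim T = p"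
    using choose_subspace_of_subspace by metis
  then show ?thesis by (auto simp: subspaces_of_dim_def)
qed

lemma risk_sup_bdd:
  fixes D :: "real^'d^'d"
  shows "bdd_above ((\<lambda>V. \<bar>compl_proj_mat V \<bullet> D - \<nu>\<bar>) ` subspaces_of_dim p)"
proof (rule bdd_aboveI2)
  fix V :: "(real^'d) set" assume V: "V \<in> subspaces_of_dim p"
  have "\<bar>compl_proj_mat V \<bullet> D\<bar> \<le> norm (compl_proj_mat V) * norm D" by (rule Cauchy_Schwarz_ineq2)
  also have "norm (compl_proj_mat V) = sqrt (real (CARD('d) - p))"
    using V norm_proj_mats(1) by (auto simp: subspaces_of_dim_def)
  finally show "\<bar>compl_proj_mat V \<bullet> D - \<nu>\<bar> \<le> sqrt (real (CARD('d) - p)) * norm D + \<bar>\<nu>\<bar>" by linarith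
qed

lemma risk_sup_upper:
  "V \<in> subspaces_of_dim p \<Longrightarrow> \<bar>compl_proj_mat V \<bullet> D - \<nu>\<bar> \<le> risk_sup p D \<nu>"
  unfolding risk_sup_def by (rule cSUP_upper[OF _ risk_sup_bdd])

lemma risk_sup_least:
  fixes D :: "real^'d^'d"
  assumes "p \<le> CARD('d)" "\<And>V. V \<in> subspaces_of_dim p \<Longrightarrow> \<bar>compl_proj_mat V \<bullet> D - \<nu>\<bar> \<le> c"
  shows "risk_sup p D \<nu> \<le> c"
  unfolding risk_sup_def by (rule cSUP_least[OF subspaces_of_dim_nonempty[OF assms(1)] assms(2)])

lemma risk_sup_nonneg:
  fixes D :: "real^'d^'d"
  assumes p: "p \<le> CARD('d)"
  shows "0 \<le> risk_sup p D \<nu>"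
proof -
  obtain V :: "(real^'d) set" where "V \<in> subspaces_of_dim p" using subspaces_of_dim_nonempty[OF p] by blast
  then show ?thesis by (rule order_trans[OF abs_ge_zero risk_sup_upper])
qed

lemma risk_sup_diff_le:
  fixes D D' :: "real^'d^'d"
  assumes p: "p \<le> CARD('d)"
    and le: "\<And>V. V \<in> subspaces_of_dim p \<Longrightarrow>
      \<bar>(compl_proj_mat V \<bullet> D - \<nu>) - (compl_proj_mat V \<bullet> D' - \<nu>')\<bar> \<le> c"
  shows "\<bar>risk_sup p D \<nu> - risk_sup p D' \<nu>'\<bar> \<le> c"
proof -
  have "risk_sup p D \<nu> \<le> risk_sup p D' \<nu>' + c"
    by (rule risk_sup_least[OF p]) (use le risk_sup_upper[of _ p D' \<nu>'] in fastforce)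
  moreover have "risk_sup p D' \<nu>' \<le> risk_sup p D \<nu> + c"
    by (rule risk_sup_least[OF p]) (use le risk_sup_upper[of _ p D \<nu>] in fastforce)
  ultimately show ?thesis by linarith
qed

text \<open>
  Although the supremum ranges over uncountably many subspaces, it is a Lipschitz function of
  \<open>(D, \<nu>)\<close>, because the projection matrices have a common norm; this settles measurability.
\<close>
lemma risk_sup_measurable:
  assumes p: "p \<le> CARD('d)"
    and [measurable]: "D \<in> borel_measurable M" "\<nu> \<in> borel_measurable M"
  shows "(\<lambda>x. risk_sup p (D x :: real^'d^'d) (\<nu> x)) \<in> borel_measurable M"
proof -
  define C where "C = sqrt (real (CARD('d) - p)) + 1"
  have "C-lipschitz_on UNIV (\<lambda>(D :: real^'d^'d, \<nu>). risk_sup p D \<nu>)"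
  proof (rule lipschitz_onI)
    fix x y :: "(real^'d^'d) \<times> real"
    obtain D \<nu> D' \<nu>' where xy: "x = (D, \<nu>)" "y = (D', \<nu>')" by (metis surj_pair)
    have d1: "norm (D - D') \<le> dist x y" "\<bar>\<nu> - \<nu>'\<bar> \<le> dist x y"
      using dist_fst_le[of x y] dist_snd_le[of x y] by (simp_all add: xy dist_norm)
    have "\<bar>risk_sup p D \<nu> - risk_sup p D' \<nu>'\<bar> \<le> C * dist x y"
    proof (rule risk_sup_diff_le[OF p])
      fix V :: "(real^'d) set" assume V: "V \<in> subspaces_of_dim p"
      have "\<bar>compl_proj_mat V \<bullet> (D - D')\<bar> \<le> norm (compl_proj_mat V) * norm (D - D')"
        by (rule Cauchy_Schwarz_ineq2)
      also have "norm (compl_proj_mat V) = sqrt (real (CARD('d) - p))"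
        using V norm_proj_mats(1) by (auto simp: subspaces_of_dim_def)
      also have "sqrt (real (CARD('d) - p)) * norm (D - D') \<le> sqrt (real (CARD('d) - p)) * dist x y"
        using d1 by (intro mult_left_mono) auto
      finally show "\<bar>(compl_proj_mat V \<bullet> D - \<nu>) - (compl_proj_mat V \<bullet> D' - \<nu>')\<bar> \<le> C * dist x y"
        using d1 by (simp add: C_def inner_diff_right algebra_simps)
    qed
    then show "dist (case x of (D, \<nu>) \<Rightarrow> risk_sup p D \<nu>) (case y of (D, \<nu>) \<Rightarrow> risk_sup p D \<nu>) \<le> C * dist x y"
      by (simp add: xy dist_real_def)
  qed (simp add: C_def)
  then have "continuous_on UNIV (\<lambda>(D :: real^'d^'d, \<nu>). risk_sup p D \<nu>)"
    by (rule lipschitz_on_continuous_on)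
  then have "(\<lambda>(D :: real^'d^'d, \<nu>). risk_sup p D \<nu>) \<in> borel_measurable borel"
    by (rule borel_measurable_continuous_onI)
  then have "(\<lambda>x. (\<lambda>(D :: real^'d^'d, \<nu>). risk_sup p D \<nu>) (D x, \<nu> x)) \<in> borel_measurable M"
    by (rule measurable_compose[rotated]) simp
  then show ?thesis by simp
qed

text \<open>
  Cauchy-Schwarz for \<open>compl_proj_mat V\<close>, and for the projection onto \<open>V\<close> itself. The latter has the
  smaller norm for small \<open>p\<close>, but passing to it costs the trace of \<open>D\<close>, which is \<open>mat 1 \<bullet> D\<close>.
\<close>
lemma risk_sup_le_norm:
  fixes D :: "real^'d^'d"
  assumes p: "p \<le> CARD('d)"
  shows "risk_sup p D \<nu> \<le> sqrt (real (CARD('d) - p)) * norm D + \<bar>\<nu>\<bar>"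
    and "risk_sup p D \<nu> \<le> sqrt (real p) * norm D + \<bar>mat 1 \<bullet> D - \<nu>\<bar>"
proof -
  show "risk_sup p D \<nu> \<le> sqrt (real (CARD('d) - p)) * norm D + \<bar>\<nu>\<bar>"
  proof (rule risk_sup_least[OF p])
    fix V :: "(real^'d) set" assume V: "V \<in> subspaces_of_dim p"
    have "\<bar>compl_proj_mat V \<bullet> D\<bar> \<le> norm (compl_proj_mat V) * norm D" by (rule Cauchy_Schwarz_ineq2)
    also have "norm (compl_proj_mat V) = sqrt (real (CARD('d) - p))"
      using V norm_proj_mats(1) by (auto simp: subspaces_of_dim_def)
    finally show "\<bar>compl_proj_mat V \<bullet> D - \<nu>\<bar> \<le> sqrt (real (CARD('d) - p)) * norm D + \<bar>\<nu>\<bar>" by linarith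
  qed
  show "risk_sup p D \<nu> \<le> sqrt (real p) * norm D + \<bar>mat 1 \<bullet> D - \<nu>\<bar>"
  proof (rule risk_sup_least[OF p])
    fix V :: "(real^'d) set" assume V: "V \<in> subspaces_of_dim p"
    have "\<bar>(mat 1 - compl_proj_mat V) \<bullet> D\<bar> \<le> norm (mat 1 - compl_proj_mat V) * norm D"
      by (rule Cauchy_Schwarz_ineq2)
    also have "norm (mat 1 - compl_proj_mat V) = sqrt (real p)"
      using V norm_proj_mats(2) by (auto simp: subspaces_of_dim_def)
    finally show "\<bar>compl_proj_mat V \<bullet> D - \<nu>\<bar> \<le> sqrt (real p) * norm D + \<bar>mat 1 \<bullet> D - \<nu>\<bar>"
      by (simp add: inner_diff_left) 
  qed
qed

section \<open>Order statistics and tail quantiles\<close>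

text \<open>
  All that is used about order statistics: these two counts determine on which side of a given level
  the order statistic lies, whether or not there are ties.
\<close>
lemma norm_order_stat_counts:
  fixes x :: "nat \<Rightarrow> 'b::real_normed_vector"
  assumes "m < n"
  shows "card {i\<in>{1..n}. norm (x i) > norm_order_stat x n (m + 1)} \<le> m"
    and "m < card {i\<in>{1..n}. norm (x i) \<ge> norm_order_stat x n (m + 1)}"
proof -
  define zs where "zs = sort (map (\<lambda>i. norm (x i)) [1..<Suc n])"
  define ys where "ys = rev zs"
  have len: "length ys = n" "length zs = n" by (simp_all add: ys_def zs_def)
  have desc: "ys ! j \<le> ys ! i" if "i \<le> j" "j < n" for i j
    using that by (simp add: ys_def rev_nth len zs_def[symmetric])
       (rule sorted_nth_mono, auto simp: zs_def)
  have ord: "norm_order_stat x n (m + 1) = ys ! m"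
    by (simp add: norm_order_stat_def ys_def zs_def)
  have count: "card {i\<in>{1..n}. P (norm (x i))} = card {j. j < n \<and> P (ys ! j)}" for P
  proof -
    have "mset ys = mset (map (\<lambda>i. norm (x i)) [1..<Suc n])" by (simp add: ys_def zs_def)
    then have "size (filter_mset P (mset ys)) = size (filter_mset P (mset (map (\<lambda>i. norm (x i)) [1..<Suc n])))"
      by (rule arg_cong)
    then have "length (filter P ys) = length (filter P (map (\<lambda>i. norm (x i)) [1..<Suc n]))"
      by (metis mset_filter size_mset)
    also have "\<dots> = length (filter (\<lambda>i. P (norm (x i))) [1..<Suc n])"
      by (simp only: filter_map length_map comp_def)
    also have "\<dots> = card ({i. P (norm (x i))} \<inter> set [1..<Suc n])"
      by (rule distinct_length_filter) (rule distinct_upt)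
    also have "{i. P (norm (x i))} \<inter> set [1..<Suc n] = {i\<in>{1..n}. P (norm (x i))}" by auto
    finally show ?thesis by (simp add: length_filter_conv_card len)
  qed
  have "{j. j < n \<and> ys ! j > ys ! m} \<subseteq> {..<m}"
    using desc assms by (auto simp: not_less[symmetric])
  from card_mono[OF _ this] show "card {i\<in>{1..n}. norm (x i) > norm_order_stat x n (m + 1)} \<le> m"
    unfolding ord count by simp
  have "{..m} \<subseteq> {j. j < n \<and> ys ! m \<le> ys ! j}" using desc assms by auto
  from card_mono[OF _ this] show "m < card {i\<in>{1..n}. norm (x i) \<ge> norm_order_stat x n (m + 1)}"
    unfolding ord count by simp
qed

lemma norm_order_stat_le_iff:
  fixes x :: "nat \<Rightarrow> 'b::real_normed_vector"
  assumes "m < n"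
  shows "norm_order_stat x n (m + 1) \<le> c \<longleftrightarrow> card {i\<in>{1..n}. c < norm (x i)} \<le> m"
proof
  assume "norm_order_stat x n (m + 1) \<le> c"
  then have "{i\<in>{1..n}. c < norm (x i)} \<subseteq> {i\<in>{1..n}. norm_order_stat x n (m + 1) < norm (x i)}" by auto
  then have "card {i\<in>{1..n}. c < norm (x i)} \<le> card {i\<in>{1..n}. norm_order_stat x n (m + 1) < norm (x i)}"
    by (intro card_mono) auto
  then show "card {i\<in>{1..n}. c < norm (x i)} \<le> m"
    using norm_order_stat_counts(1)[OF assms, of x] by linarith
next
  assume *: "card {i\<in>{1..n}. c < norm (x i)} \<le> m"
  show "norm_order_stat x n (m + 1) \<le> c"
  proof (rule ccontr)
    assume "\<not> norm_order_stat x n (m + 1) \<le> c"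
    then have "{i\<in>{1..n}. norm_order_stat x n (m + 1) \<le> norm (x i)} \<subseteq> {i\<in>{1..n}. c < norm (x i)}" by auto
    then have "card {i\<in>{1..n}. norm_order_stat x n (m + 1) \<le> norm (x i)} \<le> card {i\<in>{1..n}. c < norm (x i)}"
      by (intro card_mono) auto
    then show False using * norm_order_stat_counts(2)[OF assms, of x] by linarith
  qed
qed

text \<open>
  The event that the order statistic is at most \<open>c\<close> is a condition on the number of
  exceedances of \<open>c\<close>, hence on a finite sum of indicators.
\<close>
lemma norm_order_stat_measurable:
  fixes Z :: "nat \<Rightarrow> 'a \<Rightarrow> 'b::euclidean_space"
  assumes Z: "\<And>i. i \<in> {1..n} \<Longrightarrow> Z i \<in> borel_measurable M" and m: "m < n"
  shows "(\<lambda>\<xi>. norm_order_stat (\<lambda>i. Z i \<xi>) n (m + 1)) \<in> borel_measurable M"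
proof (rule borel_measurable_iff_le[THEN iffD2], rule allI)
  fix c :: real
  have "card {i\<in>{1..n}. c < norm (Z i \<xi>)} = (\<Sum>i=1..n. of_bool (c < norm (Z i \<xi>)))" for \<xi>
    by (simp add: sum_of_bool_eq Int_def) 
  then have "{\<xi>\<in>space M. norm_order_stat (\<lambda>i. Z i \<xi>) n (m + 1) \<le> c}
      = {\<xi>\<in>space M. (\<Sum>i=1..n. of_bool (c < norm (Z i \<xi>))) \<le> (of_nat m :: real)}"
    unfolding norm_order_stat_le_iff[OF m]
    by (metis (mono_tags, lifting) of_nat_le_iff of_nat_of_bool of_nat_sum sum.cong)
  also have "\<dots> \<in> sets M"
  proof -
    have "(\<lambda>\<xi>. of_bool (c < norm (Z i \<xi>)) :: real) \<in> borel_measurable M" if "i \<in> {1..n}" for i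
    proof -
      have [measurable]: "Z i \<in> borel_measurable M" by (rule Z[OF that])
      have "(\<lambda>\<xi>. of_bool (c < norm (Z i \<xi>)) :: real) = (\<lambda>\<xi>. if c < norm (Z i \<xi>) then 1 else 0)" by auto
      also have "\<dots> \<in> borel_measurable M" by measurable
      finally show ?thesis .
    qed
    then have [measurable]: "(\<lambda>\<xi>. \<Sum>i=1..n. of_bool (c < norm (Z i \<xi>)) :: real) \<in> borel_measurable M"
      by (rule borel_measurable_sum)
    show ?thesis by measurable
  qed
  finally show "{\<xi>\<in>space M. norm_order_stat (\<lambda>i. Z i \<xi>) n (m + 1) \<le> c} \<in> sets M" .
qed

lemma card_exceedances_eq_of_no_ties:
  fixes x :: "nat \<Rightarrow> 'b::real_normed_vector"
  assumes m: "m < n"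
    and no_ties: "\<And>i j. i \<in> {1..n} \<Longrightarrow> j \<in> {1..n} \<Longrightarrow> i \<noteq> j \<Longrightarrow>
      norm_order_stat x n (m + 1) \<le> norm (x i) \<Longrightarrow> norm (x i) \<noteq> norm (x j)"
  shows "card {i\<in>{1..n}. norm (x i) > norm_order_stat x n (m + 1)} = m"
proof -
  let ?o = "norm_order_stat x n (m + 1)"
  have "card {i\<in>{1..n}. norm (x i) = ?o} \<le> Suc 0"
  proof (subst card_le_Suc0_iff_eq)
    show "\<forall>i\<in>{i\<in>{1..n}. norm (x i) = ?o}. \<forall>j\<in>{i\<in>{1..n}. norm (x i) = ?o}. i = j"
    proof (intro ballI)
      fix i j assume "i \<in> {i\<in>{1..n}. norm (x i) = ?o}" "j \<in> {i\<in>{1..n}. norm (x i) = ?o}"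
      then show "i = j" using no_ties[of i j] by (cases "i = j") simp_all
    qed
  qed simp
  moreover have "{i\<in>{1..n}. ?o \<le> norm (x i)} = {i\<in>{1..n}. ?o < norm (x i)} \<union> {i\<in>{1..n}. norm (x i) = ?o}"
    by auto
  then have "card {i\<in>{1..n}. ?o \<le> norm (x i)} \<le> card {i\<in>{1..n}. ?o < norm (x i)} + card {i\<in>{1..n}. norm (x i) = ?o}"
    by (simp only: card_Un_le)
  ultimately show ?thesis
    using norm_order_stat_counts[OF m, of x] by linarith
qed

text \<open>
  The distribution function is at least \<open>1 - k/n\<close> to the right of the quantile and at most
  \<open>1 - k/n\<close> to the left of it, so it takes this value wherever it is continuous there.
\<close>
lemma (in prob_space) exceed_prob_tail_quantile:
  fixes X :: "'a \<Rightarrow> 'b::euclidean_space"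
  assumes X [measurable]: "X \<in> borel_measurable M" and k: "0 < k" "k < n"
    and cont: "isCont (norm_cdf M X) (tail_quantile M X n k)"
  shows "exceed_prob M X (tail_quantile M X n k) = real k / real n"
proof -
  let ?F = "norm_cdf M X"
  define q where "q = 1 - real k / real n"
  define t where "t = tail_quantile M X n k"
  have q: "0 < q" "q < 1" using k by (simp_all add: q_def)
  interpret R: real_distribution "distr M borel (\<lambda>\<xi>. norm (X \<xi>))" by (rule real_distribution_distr) simp
  have F: "?F = cdf (distr M borel (\<lambda>\<xi>. norm (X \<xi>)))" by (simp add: norm_cdf_def)
  have t: "t = Inf {x. q \<le> ?F x}" by (simp add: t_def tail_quantile_def gen_inverse_def q_def)
  have ne: "{x. q \<le> ?F x} \<noteq> {}"
    using eventually_happens[OF order_tendstoD(1)[OF R.cdf_lim_at_top_prob q(2)]]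
    by (auto simp: F intro: less_imp_le)
  have bdd: "bdd_below {x. q \<le> ?F x}"
  proof -
    obtain x0 where x0: "?F x0 < q"
      using eventually_happens[OF order_tendstoD(2)[OF R.cdf_lim_at_bot q(1)]] by (auto simp: F)
    show ?thesis
    proof (rule bdd_belowI)
      fix x assume "x \<in> {x. q \<le> ?F x}"
      then show "x0 \<le> x" using x0 R.cdf_nondecreasing[of x x0] by (force simp: F)
    qed
  qed
  have above: "q \<le> ?F x" if "t < x" for x
  proof -
    have "\<exists>y\<in>{x. q \<le> ?F x}. y < x" using cInf_lessD[OF ne, of x] that by (simp add: t)
    then obtain y where "q \<le> ?F y" "y < x" by blast
    then show ?thesis using R.cdf_nondecreasing[of y x] by (simp add: F)
  qed
  have below: "?F x \<le> q" if "x < t" for x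
    using that cInf_lower[OF _ bdd, of x] unfolding t by (force simp: not_le[symmetric])
  have lim: "(?F \<longlongrightarrow> ?F t) (at t)" using cont by (simp add: t_def isCont_def)
  have "q \<le> ?F t"
  proof (rule tendsto_lowerbound)
    show "(?F \<longlongrightarrow> ?F t) (at_right t)" using lim by (rule filterlim_mono) (auto simp: at_within_le_at)
    show "\<forall>\<^sub>F x in at_right t. q \<le> ?F x"
      unfolding eventually_at_filter by (rule always_eventually) (use above in auto)
  qed simp
  moreover have "?F t \<le> q"
  proof (rule tendsto_upperbound)
    show "(?F \<longlongrightarrow> ?F t) (at_left t)" using lim by (rule filterlim_mono) (auto simp: at_within_le_at)
    show "\<forall>\<^sub>F x in at_left t. ?F x \<le> q"
      unfolding eventually_at_filter by (rule always_eventually) (use below in auto)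
  qed simp
  ultimately have "?F t = q" by simp
  moreover have "?F t = prob {\<xi> \<in> space M. norm (X \<xi>) \<le> t}"
    unfolding F cdf_def by (subst measure_distr) (auto intro!: arg_cong[where f = prob])
  moreover have "exceed_prob M X t = 1 - prob {\<xi> \<in> space M. norm (X \<xi>) \<le> t}"
    unfolding exceed_prob_def exceedance_def
    by (subst prob_compl[symmetric]) (auto intro!: arg_cong[where f = prob])
  ultimately show ?thesis by (simp add: q_def t_def)
qed

text \<open>
  Fubini: the diagonal above \<open>s\<close> has sections that are single points, which are null for the law of \<open>V\<close>.
\<close>
lemma (in prob_space) AE_no_ties:
  fixes U V :: "'a \<Rightarrow> real"
  assumes indep: "indep_var borel U borel V"
    and atomless: "\<And>a. s \<le> a \<Longrightarrow> measure (distr M borel V) {a} = 0"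
  shows "AE \<xi> in M. U \<xi> = V \<xi> \<longrightarrow> U \<xi> < s"
proof -
  have [measurable]: "U \<in> borel_measurable M" "V \<in> borel_measurable M"
    using indep by (auto dest: indep_var_rv1 indep_var_rv2)
  interpret DU: prob_space "distr M borel U" by (rule prob_space_distr) simp
  interpret DV: prob_space "distr M borel V" by (rule prob_space_distr) simp
  have joint: "distr M (borel \<Otimes>\<^sub>M borel) (\<lambda>\<xi>. (U \<xi>, V \<xi>)) = distr M borel U \<Otimes>\<^sub>M distr M borel V"
    using indep indep_var_distribution_eq by metis
  let ?B = "{z :: real \<times> real. s \<le> fst z \<and> fst z = snd z}"
  have B: "?B \<in> sets (borel \<Otimes>\<^sub>M borel)"
  proof -
    have "{z \<in> space (borel \<Otimes>\<^sub>M borel). s \<le> fst z \<and> fst z = (snd z :: real)} \<in> sets (borel \<Otimes>\<^sub>M borel)" by measurable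
    then show ?thesis by (simp add: space_pair_measure)
  qed
  have "emeasure M {\<xi> \<in> space M. \<not> (U \<xi> = V \<xi> \<longrightarrow> U \<xi> < s)}
      = emeasure (distr M (borel \<Otimes>\<^sub>M borel) (\<lambda>\<xi>. (U \<xi>, V \<xi>))) ?B"
    by (subst emeasure_distr[OF _ B]) (auto intro!: arg_cong[where f = "emeasure M"])
  also have "\<dots> = (\<integral>\<^sup>+a. emeasure (distr M borel V) (Pair a -` ?B) \<partial>distr M borel U)"
    unfolding joint
    by (rule DV.emeasure_pair_measure_alt) (use B in \<open>simp cong: sets_pair_measure_cong\<close>)
  also have "\<dots> = (\<integral>\<^sup>+a. 0 \<partial>distr M borel U)"
  proof (rule nn_integral_cong)
    fix a :: real
    show "emeasure (distr M borel V) (Pair a -` ?B) = 0"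
    proof (cases "s \<le> a")
      case True
      then have "Pair a -` ?B = {a}" by auto
      then show ?thesis using atomless[OF True] by (simp add: DV.emeasure_eq_measure)
    qed simp
  qed
  also have "\<dots> = 0" by simp
  finally show ?thesis by (intro AE_I[where N = "{\<xi> \<in> space M. \<not> (U \<xi> = V \<xi> \<longrightarrow> U \<xi> < s)}"]) auto
qed

section \<open>Variance of sums of independent random vectors\<close>

lemma (in prob_space) indep_var_of_indep_vars:
  assumes "indep_vars N Z I" "i \<in> I" "j \<in> I" "i \<noteq> j"
  shows "indep_var (N i) (Z i) (N j) (Z j)"
proof -
  have "indep_var (PiM {i} N) (\<lambda>\<xi>. restrict (\<lambda>l. Z l \<xi>) {i}) (PiM {j} N) (\<lambda>\<xi>. restrict (\<lambda>l. Z l \<xi>) {j})"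
    by (rule indep_var_restrict[OF assms(1)]) (use assms in auto)
  then have "indep_var (N i) ((\<lambda>f. f i) \<circ> (\<lambda>\<xi>. restrict (\<lambda>l. Z l \<xi>) {i})) (N j) ((\<lambda>f. f j) \<circ> (\<lambda>\<xi>. restrict (\<lambda>l. Z l \<xi>) {j}))"
    by (rule indep_var_compose) (auto intro: measurable_component_singleton)
  then show ?thesis by (simp add: comp_def)
qed

lemma (in prob_space) real_variance_sum:
  fixes Z :: "'i \<Rightarrow> 'a \<Rightarrow> real"
  assumes I: "finite I" and indep: "indep_vars (\<lambda>_. borel) Z I"
    and bd: "\<And>i \<xi>. i \<in> I \<Longrightarrow> \<xi> \<in> space M \<Longrightarrow> \<bar>Z i \<xi>\<bar> \<le> B"
    and e: "\<And>i. i \<in> I \<Longrightarrow> expectation (Z i) = e"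
    and q: "\<And>i. i \<in> I \<Longrightarrow> expectation (\<lambda>\<xi>. (Z i \<xi>)\<^sup>2) = q"
  shows "expectation (\<lambda>\<xi>. ((\<Sum>i\<in>I. Z i \<xi>) - real (card I) * e)\<^sup>2) = real (card I) * (q - e\<^sup>2)"
proof -
  have rv: "Z i \<in> borel_measurable M" if "i \<in> I" for i
    using indep that by (auto simp: indep_vars_def)
  have int: "integrable M (Z i)" if "i \<in> I" for i
    by (rule integrable_const_bound[of _ B]) (use rv bd that in \<open>auto intro!: AE_I2\<close>)
  have int_prod: "integrable M (\<lambda>\<xi>. Z i \<xi> * Z j \<xi>)" if "i \<in> I" "j \<in> I" for i j
  proof (rule integrable_const_bound[of _ "B * B"])
    show "AE \<xi> in M. norm (Z i \<xi> * Z j \<xi>) \<le> B * B"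
      using bd that by (intro AE_I2) (force simp: abs_mult intro!: mult_mono')
    show "(\<lambda>\<xi>. Z i \<xi> * Z j \<xi>) \<in> borel_measurable M" using rv that by simp
  qed
  define Y where "Y i \<xi> = Z i \<xi> - e" for i \<xi>
  have YY: "Y i \<xi> * Y j \<xi> = Z i \<xi> * Z j \<xi> - e * Z i \<xi> - e * Z j \<xi> + e * e" for i j \<xi>
    by (simp add: Y_def algebra_simps)
  have int_YY: "integrable M (\<lambda>\<xi>. Y i \<xi> * Y j \<xi>)" if "i \<in> I" "j \<in> I" for i j
    unfolding YY using int int_prod that by simp
  have EYY: "expectation (\<lambda>\<xi>. Y i \<xi> * Y j \<xi>) = (if i = j then q - e\<^sup>2 else 0)" if ij: "i \<in> I" "j \<in> I" for i j
  proof -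
    have "expectation (\<lambda>\<xi>. Y i \<xi> * Y j \<xi>) = expectation (\<lambda>\<xi>. Z i \<xi> * Z j \<xi>) - e * e"
      unfolding YY using int int_prod e ij prob_space by simp
    also have "expectation (\<lambda>\<xi>. Z i \<xi> * Z j \<xi>) = (if i = j then q else e * e)"
    proof (cases "i = j")
      case True
      then show ?thesis using q[OF ij(1)] by (simp add: power2_eq_square)
    next
      case False
      then have "indep_var borel (Z i) borel (Z j)"
        using indep_var_of_indep_vars[OF indep ij] by blast
      then show ?thesis
        using indep_var_lebesgue_integral[of "Z i" "Z j"] int ij e False by simp
    qed
    finally show ?thesis by (simp add: power2_eq_square)
  qed
  have "((\<Sum>i\<in>I. Z i \<xi>) - real (card I) * e)\<^sup>2 = (\<Sum>i\<in>I. \<Sum>j\<in>I. Y i \<xi> * Y j \<xi>)" for \<xi>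
    by (simp add: Y_def sum_subtractf power2_eq_square flip: sum_product)
  then have "expectation (\<lambda>\<xi>. ((\<Sum>i\<in>I. Z i \<xi>) - real (card I) * e)\<^sup>2)
      = (\<Sum>i\<in>I. \<Sum>j\<in>I. expectation (\<lambda>\<xi>. Y i \<xi> * Y j \<xi>))"
    using int_YY by (simp add: Bochner_Integration.integral_sum)
  also have "\<dots> = (\<Sum>i\<in>I. \<Sum>j\<in>I. if i = j then q - e\<^sup>2 else 0)"
    by (intro sum.cong refl EYY)
  also have "\<dots> = real (card I) * (q - e\<^sup>2)" using I by simp
  finally show ?thesis .
qed

text \<open>
  The squared norm is the sum of the squared coordinates, so the scalar identity applies to each
  coordinate. In the application the vectors are matrices with the Frobenius norm, and the identity
  is exact: this is where the subtracted trace term in \<open>S_const\<close> comes from.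
\<close>
lemma (in prob_space) variance_iid_sum:
  fixes X :: "'a \<Rightarrow> 'c" and h :: "'c \<Rightarrow> 'b::euclidean_space"
  assumes I: "finite I" and indep: "indep_vars (\<lambda>_. L) Xs I"
    and law: "\<And>i. i \<in> I \<Longrightarrow> distr M L (Xs i) = distr M L X"
    and X [measurable]: "X \<in> measurable M L" and h [measurable]: "h \<in> borel_measurable L"
    and bd: "\<And>x. x \<in> space L \<Longrightarrow> norm (h x) \<le> B"
  defines "e \<equiv> expectation (\<lambda>\<xi>. h (X \<xi>))"
  shows "expectation (\<lambda>\<xi>. (norm ((\<Sum>i\<in>I. h (Xs i \<xi>)) - real (card I) *\<^sub>R e))\<^sup>2)
      = real (card I) * (expectation (\<lambda>\<xi>. (norm (h (X \<xi>)))\<^sup>2) - (norm e)\<^sup>2)"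
proof -
  have rv: "Xs i \<in> measurable M L" if "i \<in> I" for i
    using indep that by (auto simp: indep_vars_def)
  have transfer: "expectation (\<lambda>\<xi>. g (Xs i \<xi>)) = expectation (\<lambda>\<xi>. g (X \<xi>))"
    if "i \<in> I" "g \<in> borel_measurable L" for i and g :: "'c \<Rightarrow> real"
    using integral_distr[OF rv[OF that(1)] that(2)] integral_distr[OF X that(2)] law[OF that(1)] by simp
  have in_sp: "X \<xi> \<in> space L" if "\<xi> \<in> space M" for \<xi> using X that by (auto simp: measurable_def)
  have bdb: "\<bar>h x \<bullet> b\<bar> \<le> B" if "x \<in> space L" "b \<in> Basis" for x b
    using Basis_le_norm[OF that(2), of "h x"] bd[OF that(1)] by linarith
  have int: "integrable M (\<lambda>\<xi>. h (X \<xi>))"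
    by (rule integrable_const_bound[of _ B]) (use bd in_sp in \<open>auto intro!: AE_I2\<close>)
  have int2: "integrable M (\<lambda>\<xi>. (h (X \<xi>) \<bullet> b)\<^sup>2)" if b: "b \<in> Basis" for b
  proof (rule integrable_const_bound[of _ "B\<^sup>2"])
    show "AE \<xi> in M. norm ((h (X \<xi>) \<bullet> b)\<^sup>2) \<le> B\<^sup>2"
    proof (rule AE_I2)
      fix \<xi> assume "\<xi> \<in> space M"
      then show "norm ((h (X \<xi>) \<bullet> b)\<^sup>2) \<le> B\<^sup>2"
        using power_mono[OF bdb[OF in_sp b] abs_ge_zero, of \<xi> 2] by simp
    qed
  qed simp
  have normsq: "(norm v)\<^sup>2 = (\<Sum>b\<in>Basis. (v \<bullet> b)\<^sup>2)" for v :: 'b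
    unfolding power2_norm_eq_inner by (subst euclidean_inner) (simp add: power2_eq_square)
  have comp: "expectation (\<lambda>\<xi>. ((\<Sum>i\<in>I. h (Xs i \<xi>) \<bullet> b) - real (card I) * (e \<bullet> b))\<^sup>2)
      = real (card I) * (expectation (\<lambda>\<xi>. (h (X \<xi>) \<bullet> b)\<^sup>2) - (e \<bullet> b)\<^sup>2)" if b: "b \<in> Basis" for b
  proof (rule real_variance_sum[OF I, where B = B])
    show "indep_vars (\<lambda>_. borel) (\<lambda>i \<xi>. h (Xs i \<xi>) \<bullet> b) I"
      by (rule indep_vars_compose2[OF indep]) simp
    fix i assume i: "i \<in> I"
    show "expectation (\<lambda>\<xi>. h (Xs i \<xi>) \<bullet> b) = e \<bullet> b"
      using transfer[OF i, of "\<lambda>x. h x \<bullet> b"] int by (simp add: e_def)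
    show "expectation (\<lambda>\<xi>. (h (Xs i \<xi>) \<bullet> b)\<^sup>2) = expectation (\<lambda>\<xi>. (h (X \<xi>) \<bullet> b)\<^sup>2)"
      using transfer[OF i, of "\<lambda>x. (h x \<bullet> b)\<^sup>2"] by simp
    fix \<xi> assume "\<xi> \<in> space M"
    then have "Xs i \<xi> \<in> space L" using rv[OF i] by (auto simp: measurable_def)
    then show "\<bar>h (Xs i \<xi>) \<bullet> b\<bar> \<le> B" using bdb b by blast
  qed
  have intS: "integrable M (\<lambda>\<xi>. ((\<Sum>i\<in>I. h (Xs i \<xi>) \<bullet> b) - real (card I) * (e \<bullet> b))\<^sup>2)" if b: "b \<in> Basis" for b
  proof (rule integrable_const_bound[of _ "(real (card I) * B + real (card I) * \<bar>e \<bullet> b\<bar>)\<^sup>2"])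
    show "(\<lambda>\<xi>. ((\<Sum>i\<in>I. h (Xs i \<xi>) \<bullet> b) - real (card I) * (e \<bullet> b))\<^sup>2) \<in> borel_measurable M"
      using rv by simp
    show "AE \<xi> in M. norm (((\<Sum>i\<in>I. h (Xs i \<xi>) \<bullet> b) - real (card I) * (e \<bullet> b))\<^sup>2)
        \<le> (real (card I) * B + real (card I) * \<bar>e \<bullet> b\<bar>)\<^sup>2"
    proof (rule AE_I2)
      fix \<xi> assume \<xi>: "\<xi> \<in> space M"
      have "\<bar>\<Sum>i\<in>I. h (Xs i \<xi>) \<bullet> b\<bar> \<le> (\<Sum>i\<in>I. B)"
        by (rule order_trans[OF sum_abs sum_mono])
           (use bdb[OF _ b] rv \<xi> in \<open>auto simp: measurable_def\<close>)
      then have "\<bar>(\<Sum>i\<in>I. h (Xs i \<xi>) \<bullet> b) - real (card I) * (e \<bullet> b)\<bar> \<le> real (card I) * B + real (card I) * \<bar>e \<bullet> b\<bar>"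
        using abs_triangle_ineq4[of "\<Sum>i\<in>I. h (Xs i \<xi>) \<bullet> b" "real (card I) * (e \<bullet> b)"]
        by (simp add: abs_mult)
      then have "((\<Sum>i\<in>I. h (Xs i \<xi>) \<bullet> b) - real (card I) * (e \<bullet> b))\<^sup>2 \<le> (real (card I) * B + real (card I) * \<bar>e \<bullet> b\<bar>)\<^sup>2"
        by (metis abs_ge_zero power2_abs power_mono)
      then show "norm (((\<Sum>i\<in>I. h (Xs i \<xi>) \<bullet> b) - real (card I) * (e \<bullet> b))\<^sup>2)
        \<le> (real (card I) * B + real (card I) * \<bar>e \<bullet> b\<bar>)\<^sup>2" by simp
    qed
  qed
  have "expectation (\<lambda>\<xi>. (norm ((\<Sum>i\<in>I. h (Xs i \<xi>)) - real (card I) *\<^sub>R e))\<^sup>2)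
      = expectation (\<lambda>\<xi>. \<Sum>b\<in>Basis. ((\<Sum>i\<in>I. h (Xs i \<xi>) \<bullet> b) - real (card I) * (e \<bullet> b))\<^sup>2)"
    by (simp add: normsq inner_diff_left inner_sum_left)
  also have "\<dots> = (\<Sum>b\<in>Basis. real (card I) * (expectation (\<lambda>\<xi>. (h (X \<xi>) \<bullet> b)\<^sup>2) - (e \<bullet> b)\<^sup>2))"
    by (subst Bochner_Integration.integral_sum) (use intS comp in auto)
  also have "\<dots> = real (card I) * ((\<Sum>b\<in>Basis. expectation (\<lambda>\<xi>. (h (X \<xi>) \<bullet> b)\<^sup>2)) - (norm e)\<^sup>2)"
    unfolding normsq by (simp add: sum_distrib_left[symmetric] sum_subtractf)
  also have "(\<Sum>b\<in>Basis. expectation (\<lambda>\<xi>. (h (X \<xi>) \<bullet> b)\<^sup>2)) = expectation (\<lambda>\<xi>. (norm (h (X \<xi>)))\<^sup>2)"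
    unfolding normsq by (rule Bochner_Integration.integral_sum[symmetric]) (rule int2)
  finally show ?thesis .
qed

lemma (in prob_space) expectation_le_sqrt_second_moment:
  fixes f :: "'a \<Rightarrow> real"
  assumes "integrable M f" "integrable M (\<lambda>x. (f x)\<^sup>2)"
  shows "expectation f \<le> sqrt (expectation (\<lambda>x. (f x)\<^sup>2))"
proof (rule real_le_rsqrt)
  show "(expectation f)\<^sup>2 \<le> expectation (\<lambda>x. (f x)\<^sup>2)"
    using variance_positive[of f] variance_eq[OF assms] by simp
qed

section \<open>The sample beyond a fixed threshold\<close>

lemma rescale_measurable:
  fixes w :: "'b::euclidean_space \<Rightarrow> real"
  assumes "w \<in> borel_measurable (restrict_space borel (- {0}))"
  shows "rescale w \<in> borel_measurable borel"
proof -
  have m: "(\<lambda>x. indicator (- {0}) x *\<^sub>R w x) \<in> borel_measurable borel"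
    using assms by (subst (asm) borel_measurable_restrict_space_iff) auto
  have "rescale w = (\<lambda>x. (indicator (- {0}) x *\<^sub>R w x) *\<^sub>R x)"
    by (auto simp: rescale_def indicator_def fun_eq_iff)
  also have "\<dots> \<in> borel_measurable borel" by (rule borel_measurable_scaleR[OF m]) simp
  finally show ?thesis .
qed

lemma norm_rescale_le_1:
  assumes "\<And>x. x \<noteq> 0 \<Longrightarrow> 0 < w x" "\<And>x. x \<noteq> 0 \<Longrightarrow> w x \<le> 1 / norm x"
  shows "norm (rescale w x) \<le> 1"
proof (cases "x = 0")
  case False
  then show ?thesis
    using assms[OF False] by (simp add: rescale_def field_simps)
qed (simp add: rescale_def)

text \<open>
  The threshold \<open>t\<close> is any level with exceedance probability \<open>k/n\<close> above which the law of the norm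
  has no atoms; these two properties are what the quantile supplies.
\<close>
locale rescaled_sample = prob_space M for M :: "'a measure" +
  fixes X :: "'a \<Rightarrow> real^'d" and Xs :: "nat \<Rightarrow> 'a \<Rightarrow> real^'d"
    and w :: "real^'d \<Rightarrow> real" and n k :: nat and t :: real
  assumes X_meas [measurable]: "X \<in> borel_measurable M"
    and indep: "indep_vars (\<lambda>_. borel) Xs {1..n}"
    and law: "\<And>i. i \<in> {1..n} \<Longrightarrow> distr M borel (Xs i) = distr M borel X"
    and rescale_meas [measurable]: "rescale w \<in> borel_measurable borel"
    and norm_rescale: "\<And>x. norm (rescale w x) \<le> 1"
    and k: "1 \<le> k" "k < n"
    and exceed_t: "exceed_prob M X t = real k / real n"
    and atomless: "\<And>s. t \<le> s \<Longrightarrow> measure (distr M borel (\<lambda>\<xi>. norm (X \<xi>))) {s} = 0"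
begin

abbreviation large :: "real^'d \<Rightarrow> real" where
  "large \<equiv> indicator {y. t < norm y}"

definition trunc_outer :: "real^'d \<Rightarrow> real^'d^'d" where
  "trunc_outer x = large x *\<^sub>R outer (rescale w x)"

abbreviation second_moment :: "real^'d^'d" where
  "second_moment \<equiv> cond_second_moment M w X t"

text \<open>
  The factor \<open>1 / k\<close> is a normalisation by the expected number \<open>n (k / n)\<close> of points beyond \<open>t\<close>,
  which makes both errors centred.
\<close>
definition moment_error :: "(nat \<Rightarrow> real^'d) \<Rightarrow> real^'d^'d" where
  "moment_error x = (1 / real k) *\<^sub>R (\<Sum>i=1..n. trunc_outer (x i)) - second_moment"

definition count_error :: "(nat \<Rightarrow> real^'d) \<Rightarrow> real" where
  "count_error x = (1 / real k) * (\<Sum>i=1..n. large (x i)) - 1"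

text \<open>
  The two arguments of the maximum are the two ends between which the deviation for the empirical
  threshold can lie. Bounding them together, instead of adding a bound for \<open>count_error\<close> to a bound
  for \<open>moment_error\<close>, keeps the influence of a single point at \<open>1 / k\<close>.
\<close>
definition envelope :: "nat \<Rightarrow> (nat \<Rightarrow> real^'d) \<Rightarrow> real" where
  "envelope p x = max (risk_sup p (moment_error x) 0) (risk_sup p (moment_error x) (count_error x))"

lemma Xs_meas: "i \<in> {1..n} \<Longrightarrow> Xs i \<in> borel_measurable M"
  using indep by (auto simp: indep_vars_def)

lemma trunc_outer_meas [measurable]: "trunc_outer \<in> borel_measurable borel"
proof -
  have "(\<lambda>x. outer (rescale w x)) \<in> borel_measurable borel"
    by (rule measurable_compose[OF rescale_meas outer_measurable])
  then show ?thesis unfolding trunc_outer_def by simp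
qed

lemma norm_trunc_outer: "norm (trunc_outer x) = large x * (norm (rescale w x))\<^sup>2"
  by (simp add: trunc_outer_def norm_outer)

lemma norm_trunc_outer_le: "norm (trunc_outer x) \<le> 1"
  using norm_rescale[of x] by (simp add: norm_trunc_outer indicator_def abs_square_le_1)

lemma cond_expect_eq:
  fixes f :: "'a \<Rightarrow> 'c::{banach, second_countable_topology}"
  assumes [measurable]: "f \<in> borel_measurable M"
  shows "cond_expect M X t f = (real n / real k) *\<^sub>R expectation (\<lambda>\<xi>. large (X \<xi>) *\<^sub>R f \<xi>)"
proof -
  let ?A = "exceedance M X t"
  have A [measurable]: "?A \<in> sets M" unfolding exceedance_def by measurable
  have eA: "emeasure M ?A = ennreal (real k / real n)"
    using exceed_t by (simp add: exceed_prob_def emeasure_eq_measure)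
  have "uniform_measure M ?A = density M (\<lambda>\<xi>. ennreal ((real n / real k) * indicator ?A \<xi>))"
    unfolding uniform_measure_def eA
  proof (rule arg_cong[where f = "density M"], rule ext)
    fix \<xi>
    have "1 / ennreal (real k / real n) = ennreal (real n / real k)"
      using k divide_ennreal[of 1 "real k / real n"] by simp
    then show "indicator ?A \<xi> / ennreal (real k / real n) = ennreal ((real n / real k) * indicator ?A \<xi>)"
      by (simp add: indicator_def)
  qed
  then have "cond_expect M X t f = expectation (\<lambda>\<xi>. ((real n / real k) * indicator ?A \<xi>) *\<^sub>R f \<xi>)"
    unfolding cond_expect_def by (simp add: integral_density)
  also have "\<dots> = expectation (\<lambda>\<xi>. (real n / real k) *\<^sub>R (large (X \<xi>) *\<^sub>R f \<xi>))"
    by (rule Bochner_Integration.integral_cong) (auto simp: exceedance_def indicator_def)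
  also have "\<dots> = (real n / real k) *\<^sub>R expectation (\<lambda>\<xi>. large (X \<xi>) *\<^sub>R f \<xi>)"
    by (rule integral_scaleR_right)
  finally show ?thesis .
qed

lemma expectation_large: "expectation (\<lambda>\<xi>. large (X \<xi>)) = real k / real n"
proof -
  have "expectation (\<lambda>\<xi>. large (X \<xi>)) = expectation (indicator (exceedance M X t))"
    by (rule Bochner_Integration.integral_cong) (auto simp: exceedance_def indicator_def)
  also have "\<dots> = exceed_prob M X t"
    by (simp add: exceed_prob_def exceedance_def Int_def conj_commute)
  finally show ?thesis by (simp add: exceed_t)
qed

lemma trunc_outer_integrable: "integrable M (\<lambda>\<xi>. trunc_outer (X \<xi>))"
  by (rule integrable_const_bound[of _ 1]) (simp_all add: norm_trunc_outer_le)

lemma second_moment_eq: "second_moment = (real n / real k) *\<^sub>R expectation (\<lambda>\<xi>. trunc_outer (X \<xi>))"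
proof -
  have "(\<lambda>\<xi>. outer (rescale w (X \<xi>))) \<in> borel_measurable M"
    by (rule measurable_compose[OF X_meas measurable_compose[OF rescale_meas outer_measurable]])
  then show ?thesis
    unfolding cond_second_moment_def trunc_outer_def outer_def[symmetric] by (rule cond_expect_eq)
qed

lemma expectation_trunc_outer: "expectation (\<lambda>\<xi>. trunc_outer (X \<xi>)) = (real k / real n) *\<^sub>R second_moment"
  using k by (simp add: second_moment_eq)

lemma risk_eq:
  assumes "subspace V"
  shows "risk M w X t V = compl_proj_mat V \<bullet> second_moment"
proof -
  have [measurable]: "(\<lambda>\<xi>. outer (rescale w (X \<xi>))) \<in> borel_measurable M"
    by (rule measurable_compose[OF X_meas measurable_compose[OF rescale_meas outer_measurable]])
  have "risk M w X t V = (real n / real k) *\<^sub>R expectation (\<lambda>\<xi>. large (X \<xi>) *\<^sub>R (compl_proj_mat V \<bullet> outer (rescale w (X \<xi>))))"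
    unfolding risk_def compl_proj_mat_inner_outer[OF assms, symmetric] by (rule cond_expect_eq) simp
  also have "expectation (\<lambda>\<xi>. large (X \<xi>) *\<^sub>R (compl_proj_mat V \<bullet> outer (rescale w (X \<xi>))))
      = expectation (\<lambda>\<xi>. compl_proj_mat V \<bullet> trunc_outer (X \<xi>))"
    by (simp add: trunc_outer_def)
  also have "\<dots> = compl_proj_mat V \<bullet> expectation (\<lambda>\<xi>. trunc_outer (X \<xi>))"
    using trunc_outer_integrable by simp
  finally show ?thesis by (simp add: second_moment_eq)
qed

lemma compl_proj_trunc_outer_bounds:
  assumes "subspace V"
  shows "0 \<le> compl_proj_mat V \<bullet> trunc_outer x" "compl_proj_mat V \<bullet> trunc_outer x \<le> large x"
proof -
  have "(norm (rescale w x))\<^sup>2 \<le> 1" using norm_rescale[of x] by (simp add: abs_square_le_1)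
  then have "compl_proj_mat V \<bullet> outer (rescale w x) \<le> 1"
    using compl_proj_mat_inner_outer_bounds(2)[OF assms, of "rescale w x"] by linarith
  then show "compl_proj_mat V \<bullet> trunc_outer x \<le> large x"
    by (simp add: trunc_outer_def indicator_def)
  show "0 \<le> compl_proj_mat V \<bullet> trunc_outer x"
    using compl_proj_mat_inner_outer_bounds(1)[OF assms, of "rescale w x"]
    by (simp add: trunc_outer_def)
qed

lemma trace_second_moment_square: "trace (second_moment ** second_moment) = (norm second_moment)\<^sup>2"
proof -
  have entry: "expectation (\<lambda>\<xi>. trunc_outer (X \<xi>)) $ i $ j = expectation (\<lambda>\<xi>. trunc_outer (X \<xi>) $ i $ j)" for i j
    by (rule integral_bounded_linear[OF bounded_linear_compose[OF bounded_linear_vec_nth bounded_linear_vec_nth], symmetric])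
       (rule trunc_outer_integrable)
  have "trunc_outer x $ i $ j = trunc_outer x $ j $ i" for x i j
    by (simp add: trunc_outer_def outer_def)
  then have sym: "second_moment $ i $ j = second_moment $ j $ i" for i j
    unfolding second_moment_eq by (simp add: entry)
  have "trace (second_moment ** second_moment) = (\<Sum>i\<in>UNIV. \<Sum>j\<in>UNIV. second_moment $ i $ j * second_moment $ j $ i)"
    by (simp add: trace_def matrix_matrix_mult_def)
  also have "\<dots> = (\<Sum>i\<in>UNIV. \<Sum>j\<in>UNIV. second_moment $ i $ j * second_moment $ i $ j)"
    using sym by simp
  also have "\<dots> = (norm second_moment)\<^sup>2"
    by (simp add: power2_norm_eq_inner inner_vec_def)
  finally show ?thesis .
qed

lemma S_const_eq:
  "S_const M w X t = (real n / real k) * expectation (\<lambda>\<xi>. (norm (trunc_outer (X \<xi>)))\<^sup>2)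
     - (real k / real n) * (norm second_moment)\<^sup>2"
proof -
  have [measurable]: "(\<lambda>\<xi>. rescale w (X \<xi>)) \<in> borel_measurable M"
    by (rule measurable_compose[OF X_meas rescale_meas])
  have "cond_expect M X t (\<lambda>\<xi>. norm (rescale w (X \<xi>)) ^ 4)
      = (real n / real k) *\<^sub>R expectation (\<lambda>\<xi>. large (X \<xi>) *\<^sub>R norm (rescale w (X \<xi>)) ^ 4)"
    by (rule cond_expect_eq) simp
  also have "expectation (\<lambda>\<xi>. large (X \<xi>) *\<^sub>R norm (rescale w (X \<xi>)) ^ 4)
      = expectation (\<lambda>\<xi>. (norm (trunc_outer (X \<xi>)))\<^sup>2)"
    by (rule Bochner_Integration.integral_cong) (auto simp: norm_trunc_outer indicator_def simp flip: power_mult)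
  finally show ?thesis
    by (simp add: S_const_def exceed_t trace_second_moment_square)
qed

lemma sample_variance:
  fixes h :: "real^'d \<Rightarrow> 'b::euclidean_space"
  assumes h: "h \<in> borel_measurable borel" "\<And>x. norm (h x) \<le> B"
  defines "e \<equiv> expectation (\<lambda>\<xi>. h (X \<xi>))"
  shows "expectation (\<lambda>\<xi>. (norm ((1 / real k) *\<^sub>R ((\<Sum>i=1..n. h (Xs i \<xi>)) - real n *\<^sub>R e)))\<^sup>2)
      = real n / (real k)\<^sup>2 * (expectation (\<lambda>\<xi>. (norm (h (X \<xi>)))\<^sup>2) - (norm e)\<^sup>2)"
  using variance_iid_sum[OF finite_atLeastAtMost indep law X_meas h(1), of B] h(2)
  by (simp add: e_def power_mult_distrib power_divide)

lemma moment_error_eq: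
  "moment_error x = (1 / real k) *\<^sub>R ((\<Sum>i=1..n. trunc_outer (x i)) - real n *\<^sub>R expectation (\<lambda>\<xi>. trunc_outer (X \<xi>)))"
  using k by (simp add: moment_error_def expectation_trunc_outer scaleR_diff_right)

text \<open>
  The variance identity for the truncated outer products: \<open>S_const\<close> is exactly their Frobenius
  variance, scaled by \<open>n / k\<close>.
\<close>
lemma expectation_norm_moment_error_square:
  "expectation (\<lambda>\<xi>. (norm (moment_error (\<lambda>i. Xs i \<xi>)))\<^sup>2) = S_const M w X t / real k"
  using k unfolding moment_error_eq sample_variance[OF trunc_outer_meas norm_trunc_outer_le]
  by (simp add: S_const_eq expectation_trunc_outer power2_eq_square field_simps)

lemma count_error_eq:
  "count_error x = (1 / real k) *\<^sub>R ((\<Sum>i=1..n. large (x i)) - real n *\<^sub>R expectation (\<lambda>\<xi>. large (X \<xi>)))"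
  using k by (simp add: count_error_def expectation_large field_simps)

lemma sample_variance_le:
  fixes h :: "real^'d \<Rightarrow> real"
  assumes h: "h \<in> borel_measurable borel" "\<And>x. \<bar>h x\<bar> \<le> B"
  shows "expectation (\<lambda>\<xi>. ((1 / real k) *\<^sub>R ((\<Sum>i=1..n. h (Xs i \<xi>)) - real n *\<^sub>R expectation (\<lambda>\<xi>. h (X \<xi>))))\<^sup>2)
      \<le> real n / (real k)\<^sup>2 * expectation (\<lambda>\<xi>. (h (X \<xi>))\<^sup>2)"
proof -
  have "expectation (\<lambda>\<xi>. (norm ((1 / real k) *\<^sub>R ((\<Sum>i=1..n. h (Xs i \<xi>)) - real n *\<^sub>R expectation (\<lambda>\<xi>. h (X \<xi>)))))\<^sup>2)
      = real n / (real k)\<^sup>2 * (expectation (\<lambda>\<xi>. (norm (h (X \<xi>)))\<^sup>2) - (norm (expectation (\<lambda>\<xi>. h (X \<xi>))))\<^sup>2)"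
    by (rule sample_variance[OF h(1), of B]) (use h(2) in simp)
  also have "\<dots> \<le> real n / (real k)\<^sup>2 * expectation (\<lambda>\<xi>. (h (X \<xi>))\<^sup>2)"
    by (rule mult_left_mono) simp_all
  finally show ?thesis by (simp only: real_norm_def power2_abs)
qed

end

context rescaled_sample
begin

lemma envelope_measurable:
  assumes p: "p \<le> CARD('d)" and Z: "\<And>i. i \<in> {1..n} \<Longrightarrow> (\<lambda>\<xi>. Z \<xi> i) \<in> borel_measurable L"
  shows "(\<lambda>\<xi>. moment_error (Z \<xi>)) \<in> borel_measurable L"
    and "(\<lambda>\<xi>. count_error (Z \<xi>)) \<in> borel_measurable L"
    and "(\<lambda>\<xi>. envelope p (Z \<xi>)) \<in> borel_measurable L"
proof -
  have large_meas: "large \<in> borel_measurable borel" by simp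
  have "(\<lambda>\<xi>. trunc_outer (Z \<xi> i)) \<in> borel_measurable L" if "i \<in> {1..n}" for i
    by (rule measurable_compose[OF Z[OF that] trunc_outer_meas])
  then have "(\<lambda>\<xi>. \<Sum>i=1..n. trunc_outer (Z \<xi> i)) \<in> borel_measurable L" by (rule borel_measurable_sum)
  then show m [measurable]: "(\<lambda>\<xi>. moment_error (Z \<xi>)) \<in> borel_measurable L"
    unfolding moment_error_def by simp
  have "(\<lambda>\<xi>. large (Z \<xi> i) :: real) \<in> borel_measurable L" if "i \<in> {1..n}" for i
    by (rule measurable_compose[OF Z[OF that] large_meas])
  then have "(\<lambda>\<xi>. \<Sum>i=1..n. large (Z \<xi> i) :: real) \<in> borel_measurable L" by (rule borel_measurable_sum)
  then show c [measurable]: "(\<lambda>\<xi>. count_error (Z \<xi>)) \<in> borel_measurable L"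
    unfolding count_error_def by simp
  show "(\<lambda>\<xi>. envelope p (Z \<xi>)) \<in> borel_measurable L"
    unfolding envelope_def by (intro borel_measurable_max risk_sup_measurable p m c) simp
qed

lemma error_bounds:
  shows "norm (moment_error x) \<le> real n / real k + norm second_moment"
    and "\<bar>count_error x\<bar> \<le> real n / real k + 1"
proof -
  have "norm (\<Sum>i=1..n. trunc_outer (x i)) \<le> (\<Sum>i=1..n. 1)"
    by (rule sum_norm_le) (rule norm_trunc_outer_le)
  then have "norm ((1 / real k) *\<^sub>R (\<Sum>i=1..n. trunc_outer (x i))) \<le> real n / real k"
    using k by (simp add: divide_right_mono)
  then show "norm (moment_error x) \<le> real n / real k + norm second_moment"
    unfolding moment_error_def by (rule order_trans[OF norm_triangle_ineq4 add_right_mono])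
  have "(\<Sum>i=1..n. large (x i)) \<le> (\<Sum>i=1..n. 1 :: real)"
    by (rule sum_mono) (simp add: indicator_def)
  moreover have "0 \<le> (\<Sum>i=1..n. large (x i) :: real)" by (simp add: sum_nonneg)
  ultimately have "0 \<le> (1 / real k) * (\<Sum>i=1..n. large (x i))" "(1 / real k) * (\<Sum>i=1..n. large (x i)) \<le> real n / real k"
    using k by (simp_all add: divide_right_mono)
  then show "\<bar>count_error x\<bar> \<le> real n / real k + 1" unfolding count_error_def by linarith
qed

lemma envelope_le_norm:
  assumes p: "p \<le> CARD('d)"
  shows "envelope p x \<le> sqrt (real (CARD('d) - p)) * norm (moment_error x) + \<bar>count_error x\<bar>"
    and "envelope p x \<le> sqrt (real p) * norm (moment_error x)
           + sqrt ((mat 1 \<bullet> moment_error x)\<^sup>2 + (mat 1 \<bullet> moment_error x - count_error x)\<^sup>2)"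
proof -
  show "envelope p x \<le> sqrt (real (CARD('d) - p)) * norm (moment_error x) + \<bar>count_error x\<bar>"
    using risk_sup_le_norm(1)[OF p, of "moment_error x" 0]
      risk_sup_le_norm(1)[OF p, of "moment_error x" "count_error x"]
    unfolding envelope_def by simp
  let ?a = "mat 1 \<bullet> moment_error x" and ?b = "mat 1 \<bullet> moment_error x - count_error x"
  have "\<bar>?a\<bar> \<le> sqrt (?a\<^sup>2 + ?b\<^sup>2)" "\<bar>?b\<bar> \<le> sqrt (?a\<^sup>2 + ?b\<^sup>2)"
    by (rule real_le_rsqrt, simp)+
  then show "envelope p x \<le> sqrt (real p) * norm (moment_error x) + sqrt (?a\<^sup>2 + ?b\<^sup>2)"
    using risk_sup_le_norm(2)[OF p, of "moment_error x" 0]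
      risk_sup_le_norm(2)[OF p, of "moment_error x" "count_error x"]
    unfolding envelope_def by (intro max.boundedI; linarith)
qed

lemma S_const_nonneg: "0 \<le> S_const M w X t"
proof -
  have "0 \<le> expectation (\<lambda>\<xi>. (norm (moment_error (\<lambda>i. Xs i \<xi>)))\<^sup>2)" by simp
  then show ?thesis using k unfolding expectation_norm_moment_error_square by (simp add: zero_le_divide_iff)
qed

text \<open>
  The two bounds on the envelope by the norm of \<open>moment_error\<close> give the factors \<open>d - p\<close> and \<open>p\<close>. In each of
  them the remaining scalar term has second moment at most \<open>1 / k\<close>.
\<close>
lemma expectation_envelope_le:
  assumes p: "p \<le> CARD('d)"
  shows "expectation (\<lambda>\<xi>. envelope p (\<lambda>i. Xs i \<xi>))
    \<le> sqrt (real (min p (CARD('d) - p)) / real k * S_const M w X t) + 1 / sqrt (real k)"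
proof -
  let ?D = "\<lambda>\<xi>. moment_error (\<lambda>i. Xs i \<xi>)" and ?\<nu> = "\<lambda>\<xi>. count_error (\<lambda>i. Xs i \<xi>)"
  define B where "B = real n / real k + norm second_moment"
  define C where "C = real n / real k + 1"
  note meas [measurable] = envelope_measurable[OF p, of "\<lambda>\<xi> i. Xs i \<xi>" M, OF Xs_meas]
  have D_le: "norm (?D \<xi>) \<le> B" and \<nu>_le: "\<bar>?\<nu> \<xi>\<bar> \<le> C" for \<xi>
    using error_bounds by (simp_all add: B_def C_def)
  have int_D: "integrable M (\<lambda>\<xi>. norm (?D \<xi>))"
    by (rule integrable_const_bound[of _ B]) (simp_all add: D_le)
  have int_D2: "integrable M (\<lambda>\<xi>. (norm (?D \<xi>))\<^sup>2)"
    by (rule integrable_const_bound[of _ "B\<^sup>2"]) (simp_all add: D_le power_mono)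
  have int_\<nu>: "integrable M (\<lambda>\<xi>. \<bar>?\<nu> \<xi>\<bar>)"
    by (rule integrable_const_bound[of _ C]) (simp_all add: \<nu>_le)
  have int_\<nu>2: "integrable M (\<lambda>\<xi>. \<bar>?\<nu> \<xi>\<bar>\<^sup>2)"
    using power_mono[OF \<nu>_le abs_ge_zero, of _ 2]
    by (intro integrable_const_bound[of _ "C\<^sup>2"]) simp_all
  have ED: "expectation (\<lambda>\<xi>. norm (?D \<xi>)) \<le> sqrt (S_const M w X t / real k)"
    using expectation_le_sqrt_second_moment[OF int_D int_D2]
    by (simp only: expectation_norm_moment_error_square)
  have int_env: "integrable M (\<lambda>\<xi>. envelope p (\<lambda>i. Xs i \<xi>))"
  proof (rule Bochner_Integration.integrable_bound)
    show "integrable M (\<lambda>\<xi>. sqrt (real (CARD('d) - p)) * norm (?D \<xi>) + \<bar>?\<nu> \<xi>\<bar>)"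
      using int_D int_\<nu> by simp
    have "0 \<le> envelope p x" for x
      unfolding envelope_def using risk_sup_nonneg[OF p] by (simp add: le_max_iff_disj)
    then show "AE \<xi> in M. norm (envelope p (\<lambda>i. Xs i \<xi>)) \<le> norm (sqrt (real (CARD('d) - p)) * norm (?D \<xi>) + \<bar>?\<nu> \<xi>\<bar>)"
      using envelope_le_norm(1)[OF p] by (intro AE_I2) simp
  qed simp
  have first: "expectation (\<lambda>\<xi>. envelope p (\<lambda>i. Xs i \<xi>))
      \<le> sqrt (real (CARD('d) - p)) * sqrt (S_const M w X t / real k) + 1 / sqrt (real k)"
  proof -
    have "expectation (\<lambda>\<xi>. (?\<nu> \<xi>)\<^sup>2) \<le> real n / (real k)\<^sup>2 * expectation (\<lambda>\<xi>. (large (X \<xi>))\<^sup>2)"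
      unfolding count_error_eq by (rule sample_variance_le[of _ 1]) (simp_all add: indicator_def)
    also have "(\<lambda>\<xi>. (large (X \<xi>) :: real)\<^sup>2) = (\<lambda>\<xi>. large (X \<xi>))" by (simp add: indicator_def fun_eq_iff)
    also have "real n / (real k)\<^sup>2 * expectation (\<lambda>\<xi>. large (X \<xi>)) = 1 / real k"
      using k by (simp add: expectation_large power2_eq_square)
    finally have E2: "expectation (\<lambda>\<xi>. (?\<nu> \<xi>)\<^sup>2) \<le> 1 / real k" .
    have "expectation (\<lambda>\<xi>. \<bar>?\<nu> \<xi>\<bar>) \<le> sqrt (expectation (\<lambda>\<xi>. \<bar>?\<nu> \<xi>\<bar>\<^sup>2))"
      by (rule expectation_le_sqrt_second_moment[OF int_\<nu> int_\<nu>2])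
    also have "\<dots> \<le> sqrt (1 / real k)" using E2 by simp
    finally have E\<nu>: "expectation (\<lambda>\<xi>. \<bar>?\<nu> \<xi>\<bar>) \<le> 1 / sqrt (real k)" by (simp add: real_sqrt_divide)
    have "expectation (\<lambda>\<xi>. envelope p (\<lambda>i. Xs i \<xi>))
        \<le> expectation (\<lambda>\<xi>. sqrt (real (CARD('d) - p)) * norm (?D \<xi>) + \<bar>?\<nu> \<xi>\<bar>)"
      by (rule integral_mono[OF int_env]) (use int_D int_\<nu> envelope_le_norm(1)[OF p] in auto)
    also have "\<dots> = sqrt (real (CARD('d) - p)) * expectation (\<lambda>\<xi>. norm (?D \<xi>)) + expectation (\<lambda>\<xi>. \<bar>?\<nu> \<xi>\<bar>)"
      using int_D int_\<nu> by simp
    also have "\<dots> \<le> sqrt (real (CARD('d) - p)) * sqrt (S_const M w X t / real k) + 1 / sqrt (real k)"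
      using ED E\<nu> by (intro add_mono mult_left_mono) simp_all
    finally show ?thesis .
  qed
  have second: "expectation (\<lambda>\<xi>. envelope p (\<lambda>i. Xs i \<xi>))
      \<le> sqrt (real p) * sqrt (S_const M w X t / real k) + 1 / sqrt (real k)"
  proof -
    define r where "r x = mat 1 \<bullet> trunc_outer x" for x
    have r_eq: "r x = large x * (norm (rescale w x))\<^sup>2" for x
      by (simp add: r_def trunc_outer_def mat_1_inner_outer)
    have nr: "0 \<le> (norm (rescale w x))\<^sup>2" "(norm (rescale w x))\<^sup>2 \<le> 1" for x
      using norm_rescale[of x] by (simp_all add: abs_square_le_1)
    have r_bd: "0 \<le> r x" "r x \<le> large x" for x
      using nr[of x] by (simp_all add: r_eq indicator_def)
    have r_abs: "\<bar>r x\<bar> \<le> 1" and rl_bd: "\<bar>r x - large x\<bar> \<le> 1" for x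
      using r_bd[of x] by (cases "t < norm x"; simp)+
    have [measurable]: "r \<in> borel_measurable borel" unfolding r_def by simp
    have int_r: "integrable M (\<lambda>\<xi>. r (X \<xi>))"
      unfolding r_def using trunc_outer_integrable by simp
    have int_l: "integrable M (\<lambda>\<xi>. large (X \<xi>) :: real)"
      by (rule integrable_const_bound[of _ 1]) (simp_all add: indicator_def)
    let ?a = "\<lambda>\<xi>. mat 1 \<bullet> ?D \<xi>" and ?b = "\<lambda>\<xi>. mat 1 \<bullet> ?D \<xi> - ?\<nu> \<xi>"
    have a_eq: "?a \<xi> = (1 / real k) *\<^sub>R ((\<Sum>i=1..n. r (Xs i \<xi>)) - real n *\<^sub>R expectation (\<lambda>\<xi>. r (X \<xi>)))" for \<xi>
      unfolding moment_error_eq r_def using trunc_outer_integrable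
      by (simp add: inner_diff_right inner_sum_right)
    have b_eq: "?b \<xi> = (1 / real k) *\<^sub>R ((\<Sum>i=1..n. (r (Xs i \<xi>) - large (Xs i \<xi>))) - real n *\<^sub>R expectation (\<lambda>\<xi>. r (X \<xi>) - large (X \<xi>)))" for \<xi>
      unfolding a_eq count_error_eq using int_r int_l
      by (simp add: sum_subtractf algebra_simps diff_divide_distrib add_divide_distrib)
    have a2: "expectation (\<lambda>\<xi>. (?a \<xi>)\<^sup>2) \<le> real n / (real k)\<^sup>2 * expectation (\<lambda>\<xi>. (r (X \<xi>))\<^sup>2)"
      unfolding a_eq by (rule sample_variance_le[of _ 1]) (use r_abs in simp_all)
    have b2: "expectation (\<lambda>\<xi>. (?b \<xi>)\<^sup>2) \<le> real n / (real k)\<^sup>2 * expectation (\<lambda>\<xi>. (r (X \<xi>) - large (X \<xi>))\<^sup>2)"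
      unfolding b_eq by (rule sample_variance_le[of _ 1]) (use rl_bd in simp_all)
    have int_r2: "integrable M (\<lambda>\<xi>. (r (X \<xi>))\<^sup>2)" "integrable M (\<lambda>\<xi>. (r (X \<xi>) - large (X \<xi>))\<^sup>2)"
    proof -
      show "integrable M (\<lambda>\<xi>. (r (X \<xi>))\<^sup>2)"
        by (rule integrable_const_bound[of _ 1]) (use r_abs in \<open>simp_all add: abs_square_le_1\<close>)
      show "integrable M (\<lambda>\<xi>. (r (X \<xi>) - large (X \<xi>))\<^sup>2)"
        by (rule integrable_const_bound[of _ 1]) (use rl_bd in \<open>simp_all add: abs_square_le_1\<close>)
    qed
    \<comment> \<open>For \<open>0 \<le> r \<le> 1\<close> one has \<open>r\<^sup>2 + (1 - r)\<^sup>2 \<le> 1\<close>; here \<open>r\<close> is the trace of a truncated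
      outer product, and the second moments of \<open>r\<close> and of \<open>r - large\<close> share the mass of \<open>large\<close>.\<close>
    have "expectation (\<lambda>\<xi>. (r (X \<xi>))\<^sup>2) + expectation (\<lambda>\<xi>. (r (X \<xi>) - large (X \<xi>))\<^sup>2)
        = expectation (\<lambda>\<xi>. (r (X \<xi>))\<^sup>2 + (r (X \<xi>) - large (X \<xi>))\<^sup>2)"
      using int_r2 by simp
    also have "\<dots> \<le> expectation (\<lambda>\<xi>. large (X \<xi>))"
    proof (rule integral_mono)
      show "integrable M (\<lambda>\<xi>. (r (X \<xi>))\<^sup>2 + (r (X \<xi>) - large (X \<xi>))\<^sup>2)" using int_r2 by simp
      show "integrable M (\<lambda>\<xi>. large (X \<xi>) :: real)" by (rule int_l)
      fix \<xi>
      have "z\<^sup>2 + (z - 1)\<^sup>2 \<le> 1" if "0 \<le> z" "z \<le> 1" for z :: real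
      proof -
        have "0 \<le> z * (1 - z)" using that by simp
        then show ?thesis by (simp add: power2_eq_square algebra_simps)
      qed
      then show "(r (X \<xi>))\<^sup>2 + (r (X \<xi>) - large (X \<xi>))\<^sup>2 \<le> large (X \<xi>)"
        using r_bd[of "X \<xi>"] by (cases "t < norm (X \<xi>)") simp_all
    qed
    also have "\<dots> = real k / real n" by (rule expectation_large)
    finally have sum2: "expectation (\<lambda>\<xi>. (r (X \<xi>))\<^sup>2) + expectation (\<lambda>\<xi>. (r (X \<xi>) - large (X \<xi>))\<^sup>2) \<le> real k / real n" .
    define g where "g \<xi> = sqrt ((?a \<xi>)\<^sup>2 + (?b \<xi>)\<^sup>2)" for \<xi>
    have [measurable]: "g \<in> borel_measurable M" unfolding g_def by simp
    have a_le: "\<bar>?a \<xi>\<bar> \<le> norm (mat 1 :: real^'d^'d) * B" for \<xi>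
      by (rule order_trans[OF Cauchy_Schwarz_ineq2 mult_left_mono[OF D_le]]) simp
    then have b_le: "\<bar>?b \<xi>\<bar> \<le> norm (mat 1 :: real^'d^'d) * B + C" for \<xi>
      using \<nu>_le[of \<xi>] a_le[of \<xi>] by linarith
    have int_a2: "integrable M (\<lambda>\<xi>. (?a \<xi>)\<^sup>2)"
      by (rule integrable_const_bound[of _ "(norm (mat 1 :: real^'d^'d) * B)\<^sup>2"])
         (use power_mono[OF a_le abs_ge_zero, of _ 2] in simp_all)
    have int_b2: "integrable M (\<lambda>\<xi>. (?b \<xi>)\<^sup>2)"
      by (rule integrable_const_bound[of _ "(norm (mat 1 :: real^'d^'d) * B + C)\<^sup>2"])
         (use power_mono[OF b_le abs_ge_zero, of _ 2] in simp_all)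
    have g2: "(g \<xi>)\<^sup>2 = (?a \<xi>)\<^sup>2 + (?b \<xi>)\<^sup>2" for \<xi> by (simp add: g_def)
    have int_g2: "integrable M (\<lambda>\<xi>. (g \<xi>)\<^sup>2)" unfolding g2 using int_a2 int_b2 by simp
    have int_g: "integrable M g" by (rule square_integrable_imp_integrable[OF _ int_g2]) simp
    have "expectation (\<lambda>\<xi>. (g \<xi>)\<^sup>2) = expectation (\<lambda>\<xi>. (?a \<xi>)\<^sup>2) + expectation (\<lambda>\<xi>. (?b \<xi>)\<^sup>2)"
      unfolding g2 using int_a2 int_b2 by simp
    also have "\<dots> \<le> real n / (real k)\<^sup>2 * (expectation (\<lambda>\<xi>. (r (X \<xi>))\<^sup>2) + expectation (\<lambda>\<xi>. (r (X \<xi>) - large (X \<xi>))\<^sup>2))"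
      using a2 b2 by (simp add: distrib_left)
    also have "\<dots> \<le> real n / (real k)\<^sup>2 * (real k / real n)"
      by (rule mult_left_mono[OF sum2]) simp
    also have "\<dots> = 1 / real k" using k by (simp add: power2_eq_square)
    finally have Eg2: "expectation (\<lambda>\<xi>. (g \<xi>)\<^sup>2) \<le> 1 / real k" .
    have "expectation g \<le> sqrt (expectation (\<lambda>\<xi>. (g \<xi>)\<^sup>2))"
      by (rule expectation_le_sqrt_second_moment[OF int_g int_g2])
    also have "\<dots> \<le> sqrt (1 / real k)" using Eg2 by simp
    finally have Eg: "expectation g \<le> 1 / sqrt (real k)" by (simp add: real_sqrt_divide)
    have "envelope p (\<lambda>i. Xs i \<xi>) \<le> sqrt (real p) * norm (?D \<xi>) + g \<xi>" for \<xi>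
      unfolding g_def by (rule envelope_le_norm(2)[OF p])
    then have "expectation (\<lambda>\<xi>. envelope p (\<lambda>i. Xs i \<xi>)) \<le> expectation (\<lambda>\<xi>. sqrt (real p) * norm (?D \<xi>) + g \<xi>)"
      using int_D int_g by (intro integral_mono[OF int_env]) auto
    also have "\<dots> = sqrt (real p) * expectation (\<lambda>\<xi>. norm (?D \<xi>)) + expectation g"
      using int_D int_g by simp
    also have "\<dots> \<le> sqrt (real p) * sqrt (S_const M w X t / real k) + 1 / sqrt (real k)"
      using ED Eg by (intro add_mono mult_left_mono) simp_all
    finally show ?thesis .
  qed
  have "sqrt (real (min p (CARD('d) - p)) / real k * S_const M w X t)
      = sqrt (real (min p (CARD('d) - p))) * sqrt (S_const M w X t / real k)"
    by (simp add: real_sqrt_mult[symmetric])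
  then show ?thesis using first second by (cases "p \<le> CARD('d) - p") (simp_all add: min_def)
qed

text \<open>
  With \<open>q = compl_proj_mat V \<bullet> trunc_outer y\<close>, a point \<open>y\<close> contributes \<open>q / k\<close> to the one and
  \<open>(q - large y) / k\<close> to the other family of functionals. Both lie in an interval of length
  \<open>large y / k\<close> that has \<open>0\<close> as an end point, so a replacement moves them by at most the larger of two such lengths.
\<close>
lemma envelope_osc:
  assumes p: "p \<le> CARD('d)" and i: "i \<in> {1..n}"
  shows "\<bar>envelope p x - envelope p (x(i := y))\<bar> \<le> 1 / real k * max (large (x i)) (large y)"
proof -
  let ?x' = "x(i := y)" and ?c = "1 / real k * max (large (x i)) (large y)"
  have swap: "(\<Sum>j=1..n. g (x j)) - (\<Sum>j=1..n. g (?x' j)) = g (x i) - g y" for g :: "real^'d \<Rightarrow> 'c::ab_group_add"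
  proof -
    have "(\<Sum>j\<in>{1..n} - {i}. g (?x' j)) = (\<Sum>j\<in>{1..n} - {i}. g (x j))" by (rule sum.cong) auto
    then have "(\<Sum>j=1..n. g (?x' j)) = g y + (\<Sum>j\<in>{1..n} - {i}. g (x j))"
      using sum.remove[OF finite_atLeastAtMost i, of "\<lambda>j. g (?x' j)"] by simp
    moreover have "(\<Sum>j=1..n. g (x j)) = g (x i) + (\<Sum>j\<in>{1..n} - {i}. g (x j))"
      by (rule sum.remove[OF finite_atLeastAtMost i])
    ultimately show ?thesis by (simp only: add_diff_cancel_right)
  qed
  have D: "moment_error x - moment_error ?x' = (1 / real k) *\<^sub>R (trunc_outer (x i) - trunc_outer y)"
    unfolding moment_error_def using swap[of trunc_outer] by (simp add: scaleR_diff_right[symmetric])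
  have \<nu>: "count_error x - count_error ?x' = (1 / real k) * (large (x i) - large y)"
    unfolding count_error_def using swap[of large] by (simp add: right_diff_distrib[symmetric] diff_divide_distrib[symmetric])
  have le: "\<bar>compl_proj_mat V \<bullet> (moment_error x - moment_error ?x')\<bar> \<le> ?c"
    "\<bar>compl_proj_mat V \<bullet> (moment_error x - moment_error ?x') - (count_error x - count_error ?x')\<bar> \<le> ?c"
    if V: "V \<in> subspaces_of_dim p" for V
  proof -
    define q where "q x = compl_proj_mat V \<bullet> trunc_outer x" for x
    have q: "0 \<le> q x" "q x \<le> large x" for x
      using V compl_proj_trunc_outer_bounds by (auto simp: subspaces_of_dim_def q_def)
    have m: "large (x i) \<le> max (large (x i)) (large y :: real)" "large y \<le> max (large (x i)) (large y :: real)"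
      by simp_all
    have "\<bar>q (x i) - q y\<bar> \<le> max (large (x i)) (large y)"
      using q[of "x i"] q[of y] m by linarith
    moreover have "\<bar>(q (x i) - q y) - (large (x i) - large y)\<bar> \<le> max (large (x i)) (large y)"
      using q[of "x i"] q[of y] m by linarith
    moreover have "compl_proj_mat V \<bullet> (moment_error x - moment_error ?x') = 1 / real k * (q (x i) - q y)"
      by (simp add: D q_def inner_diff_right)
    moreover have "1 / real k * (q (x i) - q y) - 1 / real k * (large (x i) - large y)
        = 1 / real k * ((q (x i) - q y) - (large (x i) - large y))" by (simp only: right_diff_distrib)
    moreover have "\<bar>1 / real k * z\<bar> = 1 / real k * \<bar>z\<bar>" for z by (simp add: abs_mult)
    ultimately show "\<bar>compl_proj_mat V \<bullet> (moment_error x - moment_error ?x')\<bar> \<le> ?c"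
      "\<bar>compl_proj_mat V \<bullet> (moment_error x - moment_error ?x') - (count_error x - count_error ?x')\<bar> \<le> ?c"
      unfolding \<nu> by (simp_all only: mult_left_mono zero_le_divide_1_iff of_nat_0_le_iff)
  qed
  have "\<bar>risk_sup p (moment_error x) 0 - risk_sup p (moment_error ?x') 0\<bar> \<le> ?c"
    by (rule risk_sup_diff_le[OF p]) (use le(1) in \<open>simp add: inner_diff_right\<close>)
  moreover have "\<bar>risk_sup p (moment_error x) (count_error x) - risk_sup p (moment_error ?x') (count_error ?x')\<bar> \<le> ?c"
  proof (rule risk_sup_diff_le[OF p])
    fix V :: "(real^'d) set" assume "V \<in> subspaces_of_dim p"
    from le(2)[OF this]
    show "\<bar>(compl_proj_mat V \<bullet> moment_error x - count_error x) - (compl_proj_mat V \<bullet> moment_error ?x' - count_error ?x')\<bar> \<le> ?c"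
      by (simp only: inner_diff_right diff_diff_eq2 diff_diff_add algebra_simps)
  qed
  ultimately show ?thesis unfolding envelope_def by linarith
qed

text \<open>
  Chernoff's bound with parameter \<open>k s / 2\<close>. It is admissible for oscillations of size \<open>1 / k\<close> as long as
  \<open>s \<le> 2\<close>, and the \<open>n\<close> variances \<open>(1 / k)\<^sup>2 (k / n)\<close> add up to \<open>1 / k\<close>.
\<close>
lemma envelope_concentration:
  assumes p: "p \<le> CARD('d)" and s: "0 \<le> s" "s \<le> 2"
  shows "prob {\<xi> \<in> space M. envelope p (\<lambda>i. Xs i \<xi>) \<ge> expectation (\<lambda>\<xi>. envelope p (\<lambda>i. Xs i \<xi>)) + s}
    \<le> exp (- (real k * s\<^sup>2 / 4))"
proof -
  have restr: "envelope p (\<lambda>i\<in>{1..n}. x i) = envelope p x" for x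
  proof -
    have "(\<Sum>j=1..n. trunc_outer ((\<lambda>i\<in>{1..n}. x i) j)) = (\<Sum>j=1..n. trunc_outer (x j))"
      "(\<Sum>j=1..n. large ((\<lambda>i\<in>{1..n}. x i) j) :: real) = (\<Sum>j=1..n. large (x j))"
      by (rule sum.cong, simp_all)+
    then show ?thesis by (simp only: envelope_def moment_error_def count_error_def)
  qed
  define l where "l = real k * s / 2"
  define B where "B = sqrt (real (CARD('d) - p)) * (real n / real k + norm second_moment) + (real n / real k + 1)"
  have "prob {\<xi> \<in> space M. envelope p (\<lambda>i\<in>{1..n}. Xs i \<xi>) \<ge> expectation (\<lambda>\<xi>. envelope p (\<lambda>i\<in>{1..n}. Xs i \<xi>)) + s}
      \<le> exp (real (card {1..n}) * (l\<^sup>2 * (1 / real k)\<^sup>2 * measure (distr M borel X) {y. t < norm y}) - l * s)"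
  proof (rule concentration_of_rare_variation[OF indep law])
    show "{1..n} \<noteq> {}" using k by auto
    show "envelope p \<in> borel_measurable (PiM {1..n} (\<lambda>_. borel))"
      using envelope_measurable(3)[OF p, of "\<lambda>x. x" "PiM {1..n} (\<lambda>_. borel)"] measurable_component_singleton
      by fastforce
    show "\<bar>envelope p x\<bar> \<le> B" for x
    proof -
      have "0 \<le> envelope p x"
        unfolding envelope_def using risk_sup_nonneg[OF p] by (simp add: le_max_iff_disj)
      moreover have "envelope p x \<le> B" unfolding B_def
        by (rule order_trans[OF envelope_le_norm(1)[OF p]]) (intro add_mono mult_left_mono error_bounds, simp)
      ultimately show ?thesis by simp
    qed
    show "l * (1 / real k) \<le> 1" using s k by (simp add: l_def)
    show "\<bar>envelope p x - envelope p (x(i := y))\<bar>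
        \<le> 1 / real k * max (indicator {y. t < norm y} (x i)) (indicator {y. t < norm y} y)"
      if "i \<in> {1..n}" for i x y by (rule envelope_osc[OF p that])
  qed (use s in \<open>simp_all add: l_def\<close>)
  also have "measure (distr M borel X) {y. t < norm y} = real k / real n"
    using exceed_t unfolding exceed_prob_def exceedance_def
    by (subst measure_distr) (auto simp: vimage_def Int_def conj_commute)
  also have "real (card {1..n}) * (l\<^sup>2 * (1 / real k)\<^sup>2 * (real k / real n)) - l * s = - (real k * s\<^sup>2 / 4)"
    using k by (simp add: l_def power2_eq_square field_simps)
  finally show ?thesis unfolding restr .
qed

end

section \<open>From the empirical threshold to the fixed one\<close>

context rescaled_sample
begin

lemma emp_risk_eq:
  assumes "subspace V"
  shows "emp_risk w x n k V = (1 / real k) * (\<Sum>i=1..n. (compl_proj_mat V \<bullet> outer (rescale w (x i))) *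
    indicator {y. norm y > norm_order_stat x n (k + 1)} (x i))"
  by (simp only: emp_risk_def compl_proj_mat_inner_outer[OF assms])

text \<open>
  If the empirical threshold is below \<open>t\<close>, the points between the two raise the risk, but at most
  by \<open>(k - N) / k\<close> as no more than \<open>k\<close> points count in total. If it is at least \<open>t\<close>, exactly \<open>k\<close> of
  the \<open>N\<close> points beyond \<open>t\<close> count, and the risk falls by at most \<open>(N - k) / k\<close>.
\<close>
lemma deviation_le_envelope:
  assumes p: "p \<le> CARD('d)"
    and count: "t \<le> norm_order_stat x n (k + 1) \<Longrightarrow> card {i\<in>{1..n}. norm (x i) > norm_order_stat x n (k + 1)} = k"
    and V: "V \<in> subspaces_of_dim p"
  shows "\<bar>emp_risk w x n k V - risk M w X t V\<bar> \<le> envelope p x"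
proof -
  let ?o = "norm_order_stat x n (k + 1)"
  let ?top = "\<lambda>i. indicator {y. norm y > ?o} (x i) :: real"
  have sV: "subspace V" using V by (simp add: subspaces_of_dim_def)
  define q where "q i = compl_proj_mat V \<bullet> outer (rescale w (x i))" for i
  have q: "0 \<le> q i" "q i \<le> 1" for i
    using compl_proj_mat_inner_outer_bounds[OF sV, of "rescale w (x i)"] norm_rescale[of "x i"]
      abs_square_le_1[of "norm (rescale w (x i))"] by (auto simp: q_def)
  define R where "R = (\<Sum>i=1..n. q i * ?top i)"
  define R' where "R' = (\<Sum>i=1..n. q i * large (x i))"
  define K where "K = (\<Sum>i=1..n. ?top i)"
  define N where "N = (\<Sum>i=1..n. large (x i) :: real)"
  have K_card: "K = real (card {i\<in>{1..n}. norm (x i) > ?o})"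
    unfolding K_def by (simp add: indicator_def Int_def)
  have K_le: "K \<le> real k"
    unfolding K_card using norm_order_stat_counts(1)[OF k(2), of x] by simp
  have E: "emp_risk w x n k V = R / real k"
    by (simp add: emp_risk_eq[OF sV] R_def q_def)
  define a where "a = compl_proj_mat V \<bullet> moment_error x"
  have a: "a = R' / real k - risk M w X t V"
    by (simp add: a_def moment_error_def risk_eq[OF sV] inner_diff_right inner_sum_right R'_def q_def
        trunc_outer_def mult.commute)
  have c: "count_error x = N / real k - 1" by (simp add: count_error_def N_def)
  have env: "\<bar>a\<bar> \<le> envelope p x" "\<bar>a - count_error x\<bar> \<le> envelope p x"
    using risk_sup_upper[OF V, of "moment_error x" 0] risk_sup_upper[OF V, of "moment_error x" "count_error x"]
    unfolding envelope_def a_def by simp_all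
  have diff: "0 \<le> (\<Sum>i=1..n. q i * (f i - g i)) \<and> (\<Sum>i=1..n. q i * (f i - g i)) \<le> (\<Sum>i=1..n. f i - g i)"
    if "\<And>i. g i \<le> f i" for f g :: "nat \<Rightarrow> real"
    using that q by (intro conjI sum_nonneg sum_mono) (simp_all add: mult_left_le_one_le)
  have between: "(0 \<le> R' - R \<and> R' - R \<le> N - real k) \<or> (0 \<le> R - R' \<and> R - R' \<le> real k - N)"
  proof (cases "t \<le> ?o")
    case True
    have "K = real k" unfolding K_card count[OF True] ..
    moreover have "?top i \<le> large (x i)" for i using True by (auto simp: indicator_def)
    ultimately show ?thesis
      using diff[of ?top "\<lambda>i. large (x i)"]
      by (simp add: R_def R'_def K_def N_def right_diff_distrib sum_subtractf)
  next
    case False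
    then have "large (x i) \<le> ?top i" for i by (auto simp: indicator_def)
    then have "0 \<le> R - R'" "R - R' \<le> K - N"
      using diff[of "\<lambda>i. large (x i)" ?top]
      by (simp_all add: R_def R'_def K_def N_def right_diff_distrib sum_subtractf)
    then show ?thesis using K_le by linarith
  qed
  define e where "e = (R - R') / real k"
  define f where "f = (real k - N) / real k"
  have dev: "emp_risk w x n k V - risk M w X t V = a + e"
    by (simp add: E a e_def diff_divide_distrib)
  have "a - count_error x = a + f"
    using k by (simp add: c f_def diff_divide_distrib)
  then have ends: "a \<le> envelope p x" "- envelope p x \<le> a" "a + f \<le> envelope p x" "- envelope p x \<le> a + f"
    using env by (simp_all add: abs_le_iff)
  have "(0 \<le> e \<and> e \<le> f) \<or> (f \<le> e \<and> e \<le> 0)"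
    using between
  proof
    assume "0 \<le> R' - R \<and> R' - R \<le> N - real k"
    then have "real k - N \<le> R - R'" "R - R' \<le> 0" by simp_all
    then show ?thesis by (simp add: e_def f_def divide_right_mono divide_nonpos_nonneg)
  next
    assume "0 \<le> R - R' \<and> R - R' \<le> real k - N"
    then show ?thesis by (simp add: e_def f_def divide_right_mono)
  qed
  then show ?thesis
    unfolding dev
  proof
    assume "0 \<le> e \<and> e \<le> f"
    then show "\<bar>a + e\<bar> \<le> envelope p x" using ends by (intro abs_leI) simp_all
  next
    assume "f \<le> e \<and> e \<le> 0"
    then show "\<bar>a + e\<bar> \<le> envelope p x" using ends by (intro abs_leI) simp_all
  qed
qed

text \<open>
  Almost surely all ties lie below \<open>t\<close>, and so below the order statistic whenever that is at least \<open>t\<close>.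
\<close>
lemma AE_count_top:
  "AE \<xi> in M. t \<le> norm_order_stat (\<lambda>i. Xs i \<xi>) n (k + 1) \<longrightarrow>
     card {i\<in>{1..n}. norm (Xs i \<xi>) > norm_order_stat (\<lambda>i. Xs i \<xi>) n (k + 1)} = k"
proof -
  have pair: "AE \<xi> in M. norm (Xs i \<xi>) = norm (Xs j \<xi>) \<longrightarrow> norm (Xs i \<xi>) < t"
    if ij: "i \<in> {1..n}" "j \<in> {1..n}" "i \<noteq> j" for i j
  proof (rule AE_no_ties)
    have "indep_vars (\<lambda>_. borel) (\<lambda>i \<xi>. norm (Xs i \<xi>)) {1..n}"
      by (rule indep_vars_compose2[OF indep]) simp
    then show "indep_var borel (\<lambda>\<xi>. norm (Xs i \<xi>)) borel (\<lambda>\<xi>. norm (Xs j \<xi>))"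
      using ij by (rule indep_var_of_indep_vars)
    have "distr M borel (\<lambda>\<xi>. norm (Xs j \<xi>)) = distr (distr M borel (Xs j)) borel norm"
      using Xs_meas[OF ij(2)] by (simp add: distr_distr comp_def)
    also have "\<dots> = distr M borel (\<lambda>\<xi>. norm (X \<xi>))"
      unfolding law[OF ij(2)] by (simp add: distr_distr comp_def)
    finally show "measure (distr M borel (\<lambda>\<xi>. norm (Xs j \<xi>))) {s} = 0" if "t \<le> s" for s
      using atomless[OF that] by simp
  qed
  have "AE \<xi> in M. \<forall>i\<in>{1..n}. \<forall>j\<in>{1..n}. i \<noteq> j \<longrightarrow> norm (Xs i \<xi>) = norm (Xs j \<xi>) \<longrightarrow> norm (Xs i \<xi>) < t"
    by (intro AE_finite_allI finite_atLeastAtMost) (use pair in auto)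
  then show ?thesis
  proof (rule AE_mp, intro AE_I2 impI)
    fix \<xi>
    assume no: "\<forall>i\<in>{1..n}. \<forall>j\<in>{1..n}. i \<noteq> j \<longrightarrow> norm (Xs i \<xi>) = norm (Xs j \<xi>) \<longrightarrow> norm (Xs i \<xi>) < t"
      and le: "t \<le> norm_order_stat (\<lambda>i. Xs i \<xi>) n (k + 1)"
    show "card {i\<in>{1..n}. norm (Xs i \<xi>) > norm_order_stat (\<lambda>i. Xs i \<xi>) n (k + 1)} = k"
      by (rule card_exceedances_eq_of_no_ties[OF k(2)]) (use no le in fastforce)
  qed
qed

text \<open>
  This is \<open>max_deviation\<close> with the quantile replaced by the threshold \<open>t\<close>.
\<close>
definition deviation :: "nat \<Rightarrow> (nat \<Rightarrow> real^'d) \<Rightarrow> real" where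
  "deviation p x = (SUP V\<in>subspaces_of_dim p. \<bar>emp_risk w x n k V - risk M w X t V\<bar>)"

lemma AE_deviation_le_envelope:
  assumes p: "p \<le> CARD('d)"
  shows "AE \<xi> in M. deviation p (\<lambda>i. Xs i \<xi>) \<le> envelope p (\<lambda>i. Xs i \<xi>)"
  using AE_count_top
proof (rule AE_mp, intro AE_I2 impI)
  fix \<xi>
  assume count: "t \<le> norm_order_stat (\<lambda>i. Xs i \<xi>) n (k + 1) \<longrightarrow>
     card {i\<in>{1..n}. norm (Xs i \<xi>) > norm_order_stat (\<lambda>i. Xs i \<xi>) n (k + 1)} = k"
  show "deviation p (\<lambda>i. Xs i \<xi>) \<le> envelope p (\<lambda>i. Xs i \<xi>)"
    unfolding deviation_def
    by (rule cSUP_least[OF subspaces_of_dim_nonempty[OF p]])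
       (rule deviation_le_envelope[OF p count[rule_format]])
qed

text \<open>
  Both risks lie in \<open>[0, 1]\<close>: the empirical one averages at most \<open>k\<close> numbers in \<open>[0, 1]\<close> with weight
  \<open>1 / k\<close>. Large deviations, for which the concentration inequality is not available, are
  thereby excluded.
\<close>
lemma deviation_le_1:
  assumes p: "p \<le> CARD('d)"
  shows "deviation p x \<le> 1"
  unfolding deviation_def
proof (rule cSUP_least[OF subspaces_of_dim_nonempty[OF p]])
  fix V :: "(real^'d) set" assume "V \<in> subspaces_of_dim p"
  then have sV: "subspace V" by (simp add: subspaces_of_dim_def)
  let ?o = "norm_order_stat x n (k + 1)"
  let ?top = "\<lambda>i. indicator {y. norm y > ?o} (x i) :: real"
  define q where "q i = compl_proj_mat V \<bullet> outer (rescale w (x i))" for i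
  have q: "0 \<le> q i" "q i \<le> 1" for i
    using compl_proj_mat_inner_outer_bounds[OF sV, of "rescale w (x i)"] norm_rescale[of "x i"]
      abs_square_le_1[of "norm (rescale w (x i))"] by (auto simp: q_def)
  have "(\<Sum>i=1..n. q i * ?top i) \<le> (\<Sum>i=1..n. ?top i)"
    by (rule sum_mono) (use q in \<open>simp add: mult_left_le_one_le\<close>)
  also have "\<dots> = real (card {i\<in>{1..n}. norm (x i) > ?o})" by (simp add: indicator_def Int_def)
  also have "\<dots> \<le> real k" using norm_order_stat_counts(1)[OF k(2), of x] by simp
  finally have "emp_risk w x n k V \<le> 1"
    using k by (simp add: emp_risk_eq[OF sV] q_def)
  moreover have "0 \<le> emp_risk w x n k V"
    unfolding emp_risk_eq[OF sV] q_def[symmetric] using q by (intro mult_nonneg_nonneg sum_nonneg) simp_all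
  moreover have int: "integrable M (\<lambda>\<xi>. compl_proj_mat V \<bullet> trunc_outer (X \<xi>))"
    using trunc_outer_integrable by simp
  have r: "risk M w X t V = real n / real k * expectation (\<lambda>\<xi>. compl_proj_mat V \<bullet> trunc_outer (X \<xi>))"
    using trunc_outer_integrable by (simp add: risk_eq[OF sV] second_moment_eq)
  have "expectation (\<lambda>\<xi>. compl_proj_mat V \<bullet> trunc_outer (X \<xi>)) \<le> expectation (\<lambda>\<xi>. large (X \<xi>))"
  proof (rule integral_mono[OF int])
    show "integrable M (\<lambda>\<xi>. large (X \<xi>) :: real)"
      by (rule integrable_const_bound[of _ 1]) (simp_all add: indicator_def)
  qed (rule compl_proj_trunc_outer_bounds(2)[OF sV])
  then have "real n / real k * expectation (\<lambda>\<xi>. compl_proj_mat V \<bullet> trunc_outer (X \<xi>)) \<le> real n / real k * (real k / real n)"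
    unfolding expectation_large by (rule mult_left_mono) simp
  then have "risk M w X t V \<le> 1" using k unfolding r by simp
  moreover have "0 \<le> risk M w X t V"
    unfolding r using compl_proj_trunc_outer_bounds(1)[OF sV] by (intro mult_nonneg_nonneg integral_nonneg) simp_all
  ultimately show "\<bar>emp_risk w x n k V - risk M w X t V\<bar> \<le> 1" by linarith
qed

lemma deviation_measurable:
  assumes p: "p \<le> CARD('d)"
  shows "(\<lambda>\<xi>. deviation p (\<lambda>i. Xs i \<xi>)) \<in> borel_measurable M"
proof -
  define o' where "o' \<xi> = norm_order_stat (\<lambda>i. Xs i \<xi>) n (k + 1)" for \<xi>
  define D where "D \<xi> = (1 / real k) *\<^sub>R (\<Sum>i=1..n. indicator {y. o' \<xi> < norm y} (Xs i \<xi>) *\<^sub>R outer (rescale w (Xs i \<xi>))) - second_moment" for \<xi>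
  have [measurable]: "o' \<in> borel_measurable M"
    unfolding o'_def by (rule norm_order_stat_measurable[OF Xs_meas k(2)])
  have "(\<lambda>\<xi>. indicator {y. o' \<xi> < norm y} (Xs i \<xi>) *\<^sub>R outer (rescale w (Xs i \<xi>))) \<in> borel_measurable M"
    if i: "i \<in> {1..n}" for i
  proof (rule borel_measurable_scaleR)
    note Xs_meas[OF i, measurable]
    have "(\<lambda>\<xi>. if o' \<xi> < norm (Xs i \<xi>) then 1 else 0 :: real) \<in> borel_measurable M" by measurable
    then show "(\<lambda>\<xi>. indicator {y. o' \<xi> < norm y} (Xs i \<xi>) :: real) \<in> borel_measurable M"
      by (simp add: indicator_def of_bool_def)
    show "(\<lambda>\<xi>. outer (rescale w (Xs i \<xi>))) \<in> borel_measurable M"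
      by (rule measurable_compose[OF Xs_meas[OF i] measurable_compose[OF rescale_meas outer_measurable]])
  qed
  then have "(\<lambda>\<xi>. \<Sum>i=1..n. indicator {y. o' \<xi> < norm y} (Xs i \<xi>) *\<^sub>R outer (rescale w (Xs i \<xi>))) \<in> borel_measurable M"
    by (rule borel_measurable_sum)
  then have D: "D \<in> borel_measurable M" unfolding D_def by simp
  have "deviation p (\<lambda>i. Xs i \<xi>) = risk_sup p (D \<xi>) 0" for \<xi>
    unfolding deviation_def risk_sup_def
  proof (rule SUP_cong[OF refl])
    fix V :: "(real^'d) set" assume "V \<in> subspaces_of_dim p"
    then have sV: "subspace V" by (simp add: subspaces_of_dim_def)
    show "\<bar>emp_risk w (\<lambda>i. Xs i \<xi>) n k V - risk M w X t V\<bar> = \<bar>compl_proj_mat V \<bullet> D \<xi> - 0\<bar>"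
      unfolding emp_risk_eq[OF sV] risk_eq[OF sV] D_def o'_def inner_diff_right inner_scaleR_right inner_sum_right
      by (simp add: mult.commute)
  qed
  then show ?thesis using risk_sup_measurable[OF p D, of "\<lambda>_. 0"] by simp
qed

end

section \<open>The exponents\<close>

text \<open>
  With \<open>a = sqrt k s\<close>, the difference of the two exponents is \<open>(2 - (a - 2)\<^sup>2) / 8\<close>, which is at most
  \<open>1 / 4\<close> and hence less than \<open>ln 2\<close>.
\<close>
lemma recentred_exponent_le:
  fixes s k :: real
  assumes k: "1 \<le> k" and s: "0 \<le> s" "1 / sqrt k \<le> s"
  shows "exp (- (k * (s - 1 / sqrt k)\<^sup>2 / 4)) \<le> 2 * exp (- (k * (s / 2)\<^sup>2 / 2))"
proof -
  define a where "a = sqrt k * s"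
  have kk: "k = (sqrt k)\<^sup>2" "sqrt k \<noteq> 0" using k by simp_all
  have "k * s\<^sup>2 = a\<^sup>2" by (subst kk(1)) (simp only: a_def power_mult_distrib)
  moreover have "k * (s - 1 / sqrt k)\<^sup>2 = (a - 1)\<^sup>2"
  proof -
    have "a - 1 = sqrt k * (s - 1 / sqrt k)" using kk(2) by (simp add: a_def right_diff_distrib)
    then have "(a - 1)\<^sup>2 = (sqrt k)\<^sup>2 * (s - 1 / sqrt k)\<^sup>2" by (simp only: power_mult_distrib)
    then show ?thesis using kk(1) by simp
  qed
  moreover have "a\<^sup>2 / 8 - (a - 1)\<^sup>2 / 4 \<le> 1 / 4"
  proof -
    have "a\<^sup>2 / 8 - (a - 1)\<^sup>2 / 4 = 1 / 4 - (a - 2)\<^sup>2 / 8" by (simp add: power2_eq_square field_simps)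
    then show ?thesis by simp
  qed
  moreover have "1 / 4 \<le> ln (2 :: real)" using ln2_ge_two_thirds by simp
  ultimately have "- (k * (s - 1 / sqrt k)\<^sup>2 / 4) \<le> ln 2 + - (k * (s / 2)\<^sup>2 / 2)"
    by (simp add: power_divide)
  then have "exp (- (k * (s - 1 / sqrt k)\<^sup>2 / 4)) \<le> exp (ln 2 + - (k * (s / 2)\<^sup>2 / 2))" by simp
  then show ?thesis by (simp only: exp_add) simp
qed

text \<open>
  Below the level \<open>1 / sqrt k\<close>, which the mean of the envelope may already exceed, the claimed
  bound is trivial.
\<close>
lemma one_le_twice_gaussian:
  fixes s k :: real
  assumes k: "1 \<le> k" and s: "0 \<le> s" "s \<le> 1 / sqrt k"
  shows "1 \<le> 2 * exp (- (k * (s / 2)\<^sup>2 / 2))"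
proof -
  have "s\<^sup>2 \<le> (1 / sqrt k)\<^sup>2" using s by (intro power_mono)
  then have "k * s\<^sup>2 \<le> 1" using k by (simp add: power_divide field_simps)
  moreover have "1 + - (k * (s / 2)\<^sup>2 / 2) \<le> exp (- (k * (s / 2)\<^sup>2 / 2))" by (rule exp_ge_add_one_self)
  ultimately show ?thesis by (simp add: power_divide)
qed

text \<open>
  The Bernstein term of the smaller of \<open>u\<close> and \<open>v\<close> alone is large enough.
\<close>
lemma gaussian_le_two_bernstein_terms:
  fixes u v k \<kappa> :: real
  assumes k: "0 \<le> k" and uv: "0 < u" "0 < v" and \<kappa>: "0 \<le> \<kappa>"
  shows "2 * exp (- (k * ((u + v) / 2)\<^sup>2 / 2))
    \<le> 2 * exp (- (k * u\<^sup>2 / (2 * (1 + \<kappa> + u / 3)))) + 2 * exp (- (k * v\<^sup>2 / (2 * (1 + v / 3))))"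
proof -
  have aux: "exp (- (k * ((u + v) / 2)\<^sup>2 / 2)) \<le> exp (- (k * z\<^sup>2 / (2 * c)))"
    if "0 < z" "z \<le> (u + v) / 2" "1 \<le> c" for z c :: real
  proof -
    have "z\<^sup>2 \<le> ((u + v) / 2)\<^sup>2" using that by (intro power_mono) auto
    then have "k * z\<^sup>2 \<le> k * ((u + v) / 2)\<^sup>2" using k by (rule mult_left_mono)
    moreover have "0 \<le> k * z\<^sup>2" using k by simp
    ultimately have "k * z\<^sup>2 / (2 * c) \<le> k * ((u + v) / 2)\<^sup>2 / 2"
      using that by (intro frac_le) auto
    then show ?thesis by simp
  qed
  show ?thesis
  proof (cases "u \<le> v")
    case True
    have "exp (- (k * ((u + v) / 2)\<^sup>2 / 2)) \<le> exp (- (k * u\<^sup>2 / (2 * (1 + \<kappa> + u / 3))))"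
      by (rule aux) (use True uv \<kappa> in auto)
    then show ?thesis by (simp add: add_increasing2)
  next
    case False
    have "exp (- (k * ((u + v) / 2)\<^sup>2 / 2)) \<le> exp (- (k * v\<^sup>2 / (2 * (1 + v / 3))))"
      by (rule aux) (use False uv in auto)
    then show ?thesis by (simp add: add_increasing)
  qed
qed

lemma (in rescaled_sample) deviation_tail:
  assumes p: "p \<le> CARD('d)" and uv: "0 < u" "0 < v"
  defines "c \<equiv> sqrt (real (min p (CARD('d) - p)) / real k * S_const M w X t)"
  shows "prob {\<xi> \<in> space M. deviation p (\<lambda>i. Xs i \<xi>) \<ge> c + u + v}
    \<le> 2 * exp (- (real k * u\<^sup>2 / (2 * (1 + real k / real n + u / 3))))
      + 2 * exp (- (real k * v\<^sup>2 / (2 * (1 + v / 3))))"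
proof -
  define s where "s = u + v"
  have s0: "0 < s" using uv by (simp add: s_def)
  have c0: "0 \<le> c" unfolding c_def using S_const_nonneg by simp
  have k1: "1 \<le> real k" using k by simp
  let ?A = "{\<xi> \<in> space M. deviation p (\<lambda>i. Xs i \<xi>) \<ge> c + u + v}"
  have env_meas: "(\<lambda>\<xi>. envelope p (\<lambda>i. Xs i \<xi>)) \<in> borel_measurable M"
    by (rule envelope_measurable(3)[OF p Xs_meas])
  have "prob ?A \<le> 2 * exp (- (real k * (s / 2)\<^sup>2 / 2))"
  proof -
    \<comment> \<open>In the first case the event is empty, in the second the bound exceeds \<open>1\<close>; only in the third does the
      envelope come in, and there it has to exceed its mean by at least \<open>s - 1 / sqrt k\<close>.\<close>
    consider "1 < s" | "s \<le> 1 / sqrt (real k)" | "1 / sqrt (real k) \<le> s" "s \<le> 1" by linarith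
    then show ?thesis
    proof cases
      case 1
      have "\<not> c + u + v \<le> deviation p x" for x
        using 1 deviation_le_1[OF p, of x] c0 by (simp add: s_def)
      then have "?A = {}" by simp
      then have "prob ?A = 0" by (simp only: measure_empty)
      then show ?thesis by simp
    next
      case 2
      then show ?thesis
        using one_le_twice_gaussian[OF k1 less_imp_le[OF s0] 2] prob_le_1[of ?A] by linarith
    next
      case 3
      let ?E = "expectation (\<lambda>\<xi>. envelope p (\<lambda>i. Xs i \<xi>))"
      let ?s' = "s - 1 / sqrt (real k)"
      have "prob ?A \<le> prob {\<xi> \<in> space M. envelope p (\<lambda>i. Xs i \<xi>) \<ge> ?E + ?s'}"
      proof (rule finite_measure_mono_AE)
        show "AE \<xi> in M. \<xi> \<in> ?A \<longrightarrow> \<xi> \<in> {\<xi> \<in> space M. envelope p (\<lambda>i. Xs i \<xi>) \<ge> ?E + ?s'}"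
          using AE_deviation_le_envelope[OF p]
          by (rule AE_mp) (use expectation_envelope_le[OF p, folded c_def] in \<open>auto simp: s_def intro!: AE_I2\<close>)
      qed (rule borel_measurable_le[OF borel_measurable_const env_meas])
      also have "\<dots> \<le> exp (- (real k * ?s'\<^sup>2 / 4))"
        by (rule envelope_concentration[OF p]) (use 3 in \<open>simp_all add: diff_le_eq add_increasing2\<close>)
      also have "\<dots> \<le> 2 * exp (- (real k * (s / 2)\<^sup>2 / 2))"
        by (rule recentred_exponent_le[OF k1 less_imp_le[OF s0] 3(1)])
      finally show ?thesis .
    qed
  qed
  also have "\<dots> \<le> 2 * exp (- (real k * u\<^sup>2 / (2 * (1 + real k / real n + u / 3))))
      + 2 * exp (- (real k * v\<^sup>2 / (2 * (1 + v / 3))))"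
    unfolding s_def by (rule gaussian_le_two_bernstein_terms) (use uv in simp_all)
  finally show ?thesis .
qed

text \<open>
  The number \<open>u\<close> is the positive root of the quadratic equation \<open>k u\<^sup>2 = 2 L (c + u / 3)\<close>.
\<close>
lemma bernstein_root:
  fixes k L c :: real
  assumes k: "0 < k" and L: "0 < L" and c: "0 < c"
  defines "u \<equiv> L / (3 * k) + sqrt ((L / (3 * k))\<^sup>2 + 2 / k * c * L)"
  shows "0 < u" and "k * u\<^sup>2 / (2 * (c + u / 3)) = L"
proof -
  define b where "b = L / (3 * k)"
  have b: "0 < b" using k L by (simp add: b_def)
  have pos: "0 \<le> b\<^sup>2 + 2 / k * c * L" using k L c by simp
  then have "0 \<le> sqrt (b\<^sup>2 + 2 / k * c * L)" by simp
  then show u0: "0 < u" using b unfolding u_def b_def[symmetric] by linarith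
  have "(u - b)\<^sup>2 = b\<^sup>2 + 2 / k * c * L"
    unfolding u_def b_def[symmetric] using pos by simp
  then have "u\<^sup>2 = 2 * b * u + 2 / k * c * L" by (simp add: power2_eq_square algebra_simps)
  then have "k * u\<^sup>2 = L * (2 * (c + u / 3))"
    using k by (simp add: b_def field_simps)
  moreover have "2 * (c + u / 3) \<noteq> 0" using u0 c by simp
  ultimately show "k * u\<^sup>2 / (2 * (c + u / 3)) = L" by simp
qed

lemma sum_of_bernstein_roots_le:
  fixes a K \<kappa> L :: real
  assumes "0 \<le> a" "0 < K" "0 \<le> \<kappa>" "0 \<le> L"
  shows "sqrt (a\<^sup>2 + 2 / K * (1 + \<kappa>) * L) + sqrt (a\<^sup>2 + 2 / K * L)
    \<le> sqrt (8 / K * (1 + \<kappa>) * L) + 2 * a"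
proof -
  let ?z = "2 / K * (1 + \<kappa>) * L"
  have z: "0 \<le> ?z" "2 / K * L \<le> ?z" "0 \<le> 2 / K * L"
    using assms by (simp_all add: algebra_simps divide_right_mono)
  have "sqrt (a\<^sup>2 + ?z) \<le> a + sqrt ?z"
    using sqrt_add_le_add_sqrt[of "a\<^sup>2" ?z] z assms by simp
  moreover have "sqrt (a\<^sup>2 + 2 / K * L) \<le> sqrt (a\<^sup>2 + ?z)" using z by simp
  moreover have "sqrt (8 / K * (1 + \<kappa>) * L) = 2 * sqrt ?z"
  proof -
    have "8 / K * (1 + \<kappa>) * L = 2\<^sup>2 * ?z" by simp
    then show ?thesis by (simp only: real_sqrt_mult real_sqrt_abs)
  qed
  ultimately show ?thesis by linarith
qed

section \<open>The deviation bound\<close>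

theorem theorem3p4:
  fixes M :: "'a measure"
    and X :: "'a \<Rightarrow> real^'d" and Xs :: "nat \<Rightarrow> 'a \<Rightarrow> real^'d"
    and w :: "real^'d \<Rightarrow> real"
    and n k p :: nat and s0 :: real
  assumes "prob_space M"
    and "X \<in> borel_measurable M"
    and "regularly_varying M X"
    and "prob_space.indep_vars M (\<lambda>_. borel) Xs {1..n}"
    and "\<forall>i\<in>{1..n}. distr M borel (Xs i) = distr M borel X"
    and "w \<in> borel_measurable (restrict_space borel (- {0}))"
    and "\<forall>x. x \<noteq> 0 \<longrightarrow> 0 < w x"
    and "\<forall>x. x \<noteq> 0 \<longrightarrow> w x \<le> 1 / norm x"
    and "1 \<le> k" and "k \<le> n - 1"
    and "1 \<le> p" and "p \<le> CARD('d)"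
    and "\<forall>t\<ge>s0. isCont (norm_cdf M X) t"
    and "s0 \<le> tail_quantile M X n k"
  shows "(\<forall>u>0. \<forall>v>0.
            {\<xi> \<in> space M. max_deviation M w X (\<lambda>i. Xs i \<xi>) n k p \<ge>
                 sqrt (real (min p (CARD('d) - p)) / real k
                       * S_const M w X (tail_quantile M X n k)) + u + v} \<in> sets M \<and>
            measure M {\<xi> \<in> space M. max_deviation M w X (\<lambda>i. Xs i \<xi>) n k p \<ge>
                 sqrt (real (min p (CARD('d) - p)) / real k
                       * S_const M w X (tail_quantile M X n k)) + u + v}
              \<le> 2 * exp (- (real k * u\<^sup>2 / (2 * (1 + real k / real n + u / 3))))
                + 2 * exp (- (real k * v\<^sup>2 / (2 * (1 + v / 3))))) \<and>
         (\<forall>\<delta>. 0 < \<delta> \<and> \<delta> < 1 \<longrightarrow>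
            measure M {\<xi> \<in> space M. max_deviation M w X (\<lambda>i. Xs i \<xi>) n k p \<le>
                 sqrt (real (min p (CARD('d) - p)) / real k
                       * S_const M w X (tail_quantile M X n k))
                 + 2 * ln (4 / \<delta>) / (3 * real k)
                 + sqrt ((ln (4 / \<delta>) / (3 * real k))\<^sup>2
                         + 2 / real k * (1 + real k / real n) * ln (4 / \<delta>))
                 + sqrt ((ln (4 / \<delta>) / (3 * real k))\<^sup>2 + 2 / real k * ln (4 / \<delta>))}
              \<ge> 1 - \<delta> \<and>
            sqrt (real (min p (CARD('d) - p)) / real k
                  * S_const M w X (tail_quantile M X n k))
              + 2 * ln (4 / \<delta>) / (3 * real k)
              + sqrt ((ln (4 / \<delta>) / (3 * real k))\<^sup>2
                      + 2 / real k * (1 + real k / real n) * ln (4 / \<delta>))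
              + sqrt ((ln (4 / \<delta>) / (3 * real k))\<^sup>2 + 2 / real k * ln (4 / \<delta>))
            \<le> sqrt (real (min p (CARD('d) - p)) / real k
                    * S_const M w X (tail_quantile M X n k))
              + sqrt (8 / real k * (1 + real k / real n) * ln (4 / \<delta>))
              + 4 * ln (4 / \<delta>) / (3 * real k))"
proof -
  define t where "t = tail_quantile M X n k"
  interpret prob_space M by (rule assms(1))
  have k: "1 \<le> k" "k < n" using assms(9,10) by simp_all
  have cont: "isCont (norm_cdf M X) s" if "t \<le> s" for s
    using assms(13,14) that unfolding t_def by (meson order_trans)
  have X [measurable]: "X \<in> borel_measurable M" by (rule assms(2))
  interpret rescaled_sample M X Xs w n k t
  proof
    show "rescale w \<in> borel_measurable borel" by (rule rescale_measurable[OF assms(6)])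
    show "norm (rescale w x) \<le> 1" for x by (rule norm_rescale_le_1) (use assms(7,8) in auto)
    show "exceed_prob M X t = real k / real n"
      unfolding t_def by (rule exceed_prob_tail_quantile[OF X]) (use k cont[of t] in \<open>simp_all add: t_def\<close>)
    show "measure (distr M borel (\<lambda>\<xi>. norm (X \<xi>))) {s} = 0" if "t \<le> s" for s
    proof -
      interpret R: real_distribution "distr M borel (\<lambda>\<xi>. norm (X \<xi>))" by (rule real_distribution_distr) simp
      show ?thesis using cont[OF that] by (simp add: norm_cdf_def R.isCont_cdf)
    qed
  qed (use assms(2,4,5) k in simp_all)
  have p: "p \<le> CARD('d)" by (rule assms(12))
  define c where "c = sqrt (real (min p (CARD('d) - p)) / real k * S_const M w X t)"
  have dev: "max_deviation M w X x n k p = deviation p x" for x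
    by (simp only: max_deviation_def deviation_def t_def[symmetric])
  have events: "{\<xi> \<in> space M. z \<le> deviation p (\<lambda>i. Xs i \<xi>)} \<in> sets M" for z
    by (rule borel_measurable_le[OF borel_measurable_const deviation_measurable[OF p]])
  have part2: "1 - \<delta> \<le> prob {\<xi> \<in> space M. deviation p (\<lambda>i. Xs i \<xi>) \<le> c + 2 * ln (4 / \<delta>) / (3 * real k)
          + sqrt ((ln (4 / \<delta>) / (3 * real k))\<^sup>2 + 2 / real k * (1 + real k / real n) * ln (4 / \<delta>))
          + sqrt ((ln (4 / \<delta>) / (3 * real k))\<^sup>2 + 2 / real k * ln (4 / \<delta>))}"
    (is "_ \<le> prob ?good")
    and part3: "c + 2 * ln (4 / \<delta>) / (3 * real k)
          + sqrt ((ln (4 / \<delta>) / (3 * real k))\<^sup>2 + 2 / real k * (1 + real k / real n) * ln (4 / \<delta>))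
          + sqrt ((ln (4 / \<delta>) / (3 * real k))\<^sup>2 + 2 / real k * ln (4 / \<delta>))
        \<le> c + sqrt (8 / real k * (1 + real k / real n) * ln (4 / \<delta>)) + 4 * ln (4 / \<delta>) / (3 * real k)"
    if \<delta>: "0 < \<delta>" "\<delta> < 1" for \<delta>
  proof -
    define L where "L = ln (4 / \<delta>)"
    have L: "0 < L" using \<delta> by (simp add: L_def)
    have eL: "exp (- L) = \<delta> / 4" using \<delta> by (simp add: L_def exp_minus)
    define u where "u = L / (3 * real k) + sqrt ((L / (3 * real k))\<^sup>2 + 2 / real k * (1 + real k / real n) * L)"
    define v where "v = L / (3 * real k) + sqrt ((L / (3 * real k))\<^sup>2 + 2 / real k * 1 * L)"
    have k0: "0 < real k" using k by simp
    have "0 < 1 + real k / real n" using k by (simp add: add_pos_nonneg)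
    note u = bernstein_root[OF k0 L this, folded u_def] and v = bernstein_root[OF k0 L zero_less_one, folded v_def]
    have "prob {\<xi> \<in> space M. deviation p (\<lambda>i. Xs i \<xi>) \<ge> c + u + v} \<le> 2 * exp (- L) + 2 * exp (- L)"
      using deviation_tail[OF p u(1) v(1)] unfolding c_def[symmetric] u(2) v(2) .
    then have "prob {\<xi> \<in> space M. deviation p (\<lambda>i. Xs i \<xi>) \<ge> c + u + v} \<le> \<delta>" by (simp add: eL)
    then have "1 - \<delta> \<le> prob (space M - {\<xi> \<in> space M. deviation p (\<lambda>i. Xs i \<xi>) \<ge> c + u + v})"
      using prob_compl[OF events[of "c + u + v"]] by linarith
    also have "\<dots> \<le> prob {\<xi> \<in> space M. deviation p (\<lambda>i. Xs i \<xi>) \<le> c + u + v}"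
      by (rule finite_measure_mono[OF _ borel_measurable_le[OF deviation_measurable[OF p] borel_measurable_const]]) auto
    also have "c + u + v = c + 2 * L / (3 * real k)
          + sqrt ((L / (3 * real k))\<^sup>2 + 2 / real k * (1 + real k / real n) * L)
          + sqrt ((L / (3 * real k))\<^sup>2 + 2 / real k * L)"
      by (simp add: u_def v_def)
    finally show "1 - \<delta> \<le> prob ?good" unfolding L_def .
    show "c + 2 * ln (4 / \<delta>) / (3 * real k)
          + sqrt ((ln (4 / \<delta>) / (3 * real k))\<^sup>2 + 2 / real k * (1 + real k / real n) * ln (4 / \<delta>))
          + sqrt ((ln (4 / \<delta>) / (3 * real k))\<^sup>2 + 2 / real k * ln (4 / \<delta>))
        \<le> c + sqrt (8 / real k * (1 + real k / real n) * ln (4 / \<delta>)) + 4 * ln (4 / \<delta>) / (3 * real k)"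
      using sum_of_bernstein_roots_le[of "L / (3 * real k)" "real k" "real k / real n" L] L k0
      unfolding L_def by simp
  qed
  show ?thesis
    unfolding t_def[symmetric] dev c_def[symmetric]
    using deviation_tail[OF p, folded c_def] events part2 part3 by blast
qed

end
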